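(* Let $\gamma>1$ and $K>0$ be fixed. Assume that $b\in C^2([0,\infty))$ satisfies $b(0)=0$ and, for all $x\ge 0$, $b'(x)>0$ and $$\frac{1}{\gamma K^2}+b'(x)^2+b(x)b''(x)>0,$$ and that, for all sufficiently small $\tau>0$ and all $x\ge0$, $$\frac{(1+\tau^2b'(x)^2)^{3/2}}{\gamma K^2}+b''(x)H_\tau(x)+b'(x)^2\sqrt{1+\tau^2b'(x)^2}>0,\qquad H_\tau(x)=\int_0^x\frac{b'(t)}{\sqrt{1+\tau^2b'(t)^2}}\,\mathrm{d}t .$$ Let $(\bar\varrho^{(\tau)},\bar u^{(\tau)},\bar v^{(\tau)},\bar E^{(\tau)})$ and $w_p^{(\tau)}$ be the scaled Radon measure solution of Problem A and its scaled pressure coefficient, and let $(\bar\varrho,\bar u,\bar v,\bar E)$ and $\bar w_p$ be the Radon measure solution of Problem B and its pressure coefficient (all given explicitly in the context). Set $\mu=\mathcal{L}^2|_{\Omega'}+\delta_{\Gamma'}$. Then, as $\tau\to0$ with $K$ and $\gamma$ fixed, $\mu$-a.e. on $\Omega'\cup\Gamma'$, $$\bar u^{(\tau)}=\bar u+o(1),\quad \bar v^{(\tau)}=\bar v+o(1),\quad \bar E^{(\tau)}=\bar E+o(1),\quad \frac{\mathrm{d}\bar\varrho^{(\tau)}}{\mathrm{d}\mu}=\tau\frac{\mathrm{d}\bar\varrho}{\mathrm{d}\mu}+o(\tau),$$ where the Radon–Nikodym derivatives are represented by their versions that are continuous on $\Omega'$ and on $\Gamma'$ separately; and for each $\bar x\ge0$,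 $$w_p^{(\tau)}(\bar x)=\bar w_p(\bar x)+o(1).$$
   Context: Notation: $m|_A$ is the restriction of a measure $m$ to a Borel set $A$; $\chi_A$ is the indicator function; $\mathcal{L}^2$ is Lebesgue measure on the plane; $\langle m,\phi\rangle=\int\phi\,\mathrm{d}m$. For a curve $L=\{(x,g(x)):x\ge0\}$ and a weight $w\in L^1_{loc}([0,\infty))$, the weighted Dirac measure $w\delta_L$ is $\langle w\delta_L,\phi\rangle=\int_0^\infty w(x)\phi(x,g(x))\sqrt{1+g'(x)^2}\,\mathrm{d}x$ for $\phi\in C_c(\mathbb{R}^2)$ (so $\delta_L$ is arc length on $L$). $\lambda\ll\mu$ denotes absolute continuity. Parameters: $0<\tau<1$ is the slenderness ratio, $M_\infty>1$ the Mach number of the oncoming flow, $K=M_\infty\tau$ the similarity parameter (kept fixed). $\rho_\infty,u_\infty>0$ are constants, $E_\infty=\frac12u_\infty^2\big(1+\frac{2\tau^2}{(\gamma-1)K^2}\big)$, $p_\infty=\frac{\rho_\infty u_\infty^2\tau^2}{\gamma K^2}$, and $\bar E_\infty=\frac{2}{(\gamma-1)K^2}$, $\bar p_\infty=\frac1{\gamma K^2}$. Domains: $\Omega=\{x\ge0,\ y>\tau b(x)\}$, $\Gamma=\{x\ge0,\ y=\tau b(x)\}$ with unit normal $(n_1,n_2)=(-\tau b',1)/\sqrt{1+\tau^2b'^2}$; $\Omega'=\{\bar x\ge0,\ \bar y>b(\bar x)\}$, $\Gamma'=\{\bar x\ge0,\ \bar y=b(\bar x)\}$ with unit normal $(\bar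 n_1,\bar n_2)=(-b',1)/\sqrt{1+b'^2}$. Problem A (supersonic steady Euler flow past the wedge): find $(\rho,u,v,E)$ in $\Omega$ solving $\partial_x(\rho u)+\partial_y(\rho v)=0$, $\partial_x(\rho u^2+p)+\partial_y(\rho uv)=0$, $\partial_x(\rho uv)+\partial_y(\rho v^2+p)=0$, $\partial_x(\rho uE)+\partial_y(\rho vE)=0$, $p=\frac{\gamma-1}{\gamma}\rho(E-\frac12(u^2+v^2))$, with oncoming flow $(\rho_\infty,u_\infty,0,E_\infty)$ at $x=0$ and slip condition $(u,v)\cdot(n_1,n_2)=0$ on $\Gamma$. A Radon measure solution is a tuple $(\varrho,u,v,E)$ for which there are nonnegative Radon measures $\varrho,\wp$ and signed Radon measures $m^i,n^i$ $(i=0,1,2,3)$ on $\overline\Omega$ and a nonnegative $w_p\in L^1_{loc}([0,\infty))$ such that: (i) for all $\phi\in C_c^1(\mathbb{R}^2)$: $\langle m^0,\partial_x\phi\rangle+\langle n^0,\partial_y\phi\rangle+\int_0^\infty\rho_\infty u_\infty\phi(0,y)\mathrm{d}y=0$; $\langle m^1+\wp,\partial_x\phi\rangle+\langle n^1,\partial_y\phi\rangle+\langle w_pn_1\delta_\Gamma,\phi\rangle+\int_0^\infty(\rho_\infty u_\infty^2+p_\infty)\phi(0,y)\mathrm{d}y=0$; $\langle m^2,\partial_x\phi\rangle+\langle n^2+\wp,\partial_y\phi\rangle+\langle w_pn_2\delta_\Gamma,\phi\rangle=0$; $\langle m^3,\partial_x\phi\rangle+\langle n^3,\partial_y\phi\rangle+\int_0^\infty\rho_\infty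 u_\infty E_\infty\phi(0,y)\mathrm{d}y=0$; (ii) $\wp,m^k,n^k\ll\varrho$ and $\varrho$-a.e. $u=\frac{\mathrm{d}m^0}{\mathrm{d}\varrho}$, $v=\frac{\mathrm{d}n^0}{\mathrm{d}\varrho}$, $u^2=\frac{\mathrm{d}m^1}{\mathrm{d}\varrho}$, $uv=\frac{\mathrm{d}n^1}{\mathrm{d}\varrho}=\frac{\mathrm{d}m^2}{\mathrm{d}\varrho}$, $v^2=\frac{\mathrm{d}n^2}{\mathrm{d}\varrho}$, $Eu=\frac{\mathrm{d}m^3}{\mathrm{d}\varrho}$, $Ev=\frac{\mathrm{d}n^3}{\mathrm{d}\varrho}$ ($u,v,E$ set to zero on $\varrho$-null sets); (iii) on any Borel set where $\varrho,\wp\ll\mathcal{L}^2$, with $\rho=\frac{\mathrm{d}\varrho}{\mathrm{d}\mathcal{L}^2}$, $p=\frac{\mathrm{d}\wp}{\mathrm{d}\mathcal{L}^2}$, one has a.e. $p=\frac{\gamma-1}{\gamma}\rho(E-\frac12(u^2+v^2))$, and the classical entropy condition holds at discontinuities of $\rho,u,v,E$. The Radon measure solution of Problem A considered is $u=u_\infty\chi_\Omega+\frac{u_\infty H_\tau(x)}{b(x)\sqrt{1+\tau^2b'(x)^2}}\chi_\Gamma$, $v=\frac{u_\infty\tau b'(x)H_\tau(x)}{b(x)\sqrt{1+\tau^2b'(x)^2}}\chi_\Gamma$, $\varrho=\rho_\infty\mathcal{L}^2|_\Omega+w_\rho(x)\delta_\Gamma$ with $w_\rho(x)=\frac{\rho_\infty\tau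 b(x)^2}{H_\tau(x)}$, $E=E_\infty\chi_\Omega+E_\infty\chi_\Gamma$ (extended to $x=0$ by limits), with $w_p(x)=p_\infty+\rho_\infty u_\infty^2\tau^2\,\frac{b''(x)H_\tau(x)+b'(x)^2\sqrt{1+\tau^2b'(x)^2}}{(1+\tau^2b'(x)^2)^{3/2}}$. Scaling: $\bar x=x$, $\bar y=y/\tau$, and at corresponding points $\bar u^{(\tau)}=\frac{u-u_\infty}{u_\infty\tau^2}$, $\bar v^{(\tau)}=\frac{v}{u_\infty\tau}$, $\bar E^{(\tau)}=\frac{2E-u_\infty^2}{u_\infty^2\tau^2}$; $w_p^{(\tau)}(\bar x)=w_p(\bar x)/(\gamma p_\infty K^2)$. The scaled mass measure $\bar\varrho^{(\tau)}$ is defined, for every $\bar\phi\in C_c(\mathbb{R}^2)$, by $$\langle\bar\varrho^{(\tau)},\bar\phi\rangle=\tau\Big(\int_{\Omega'}\bar\phi\,\mathrm{d}\bar x\mathrm{d}\bar y+\int_0^\infty\frac{w_\rho(\bar x)}{\tau\rho_\infty}\bar\phi(\bar x,b(\bar x))\sqrt{1+\tau^2b'(\bar x)^2}\,\mathrm{d}\bar x\Big).$$ Problem B (hypersonic small-disturbance problem): find $(\bar\rho,\bar u,\bar v,\bar E)$ in $\Omega'$ solving $\partial_{\bar x}\bar\rho+\partial_{\bar y}(\bar\rho\bar v)=0$, $\partial_{\bar x}(\bar\rho\bar u+\bar p)+\partial_{\bar y}(\bar\rho\bar u\bar v)=0$, $\partial_{\bar x}(\bar\rho\bar v)+\partial_{\bar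 y}(\bar\rho\bar v^2+\bar p)=0$, $\partial_{\bar x}(\bar\rho\bar E)+\partial_{\bar y}(\bar\rho\bar v\bar E)=0$, $\bar p=\frac{\gamma-1}{2\gamma}\bar\rho(\bar E-2\bar u-\bar v^2)$, with oncoming flow $(1,0,0,\bar E_\infty)$ at $\bar x=0$ and $\bar v=b'(\bar x)$ on $\Gamma'$. A Radon measure solution is a tuple $(\bar\varrho,\bar u,\bar v,\bar E)$ for which there are nonnegative Radon measures $\bar\varrho,\bar\wp$ and signed Radon measures $\bar m^i,\bar n^i$ $(i=0,\dots,3)$ on $\overline{\Omega'}$ with $\bar m^0=\bar\varrho$, $\bar n^0=\bar m^2$, and a nonnegative $\bar w_p\in L^1_{loc}([0,\infty))$ such that: (i) for all $\bar\phi\in C^1_c(\mathbb{R}^2)$: $\langle\bar m^0,\partial_{\bar x}\bar\phi\rangle+\langle\bar n^0,\partial_{\bar y}\bar\phi\rangle+\int_0^\infty\bar\phi(0,\bar y)\mathrm{d}\bar y=0$; $\langle\bar m^1+\bar\wp,\partial_{\bar x}\bar\phi\rangle+\langle\bar n^1,\partial_{\bar y}\bar\phi\rangle+\langle\bar w_p\bar n_1\delta_{\Gamma'},\bar\phi\rangle+\int_0^\infty\bar p_\infty\bar\phi(0,\bar y)\mathrm{d}\bar y=0$; $\langle\bar m^2,\partial_{\bar x}\bar\phi\rangle+\langle\bar n^2+\bar\wp,\partial_{\bar y}\bar\phi\rangle+\langle\bar w_p\bar n_2\delta_{\Gamma'},\bar\phi\rangle=0$; $\langle\bar m^3,\partial_{\bar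 x}\bar\phi\rangle+\langle\bar n^3,\partial_{\bar y}\bar\phi\rangle+\int_0^\infty\bar E_\infty\bar\phi(0,\bar y)\mathrm{d}\bar y=0$; (ii) $\bar\wp,\bar m^i,\bar n^i\ll\bar\varrho$ and $\bar\varrho$-a.e. $\bar u=\frac{\mathrm{d}\bar m^1}{\mathrm{d}\bar\varrho}$, $\bar v=\frac{\mathrm{d}\bar n^0}{\mathrm{d}\bar\varrho}=\frac{\mathrm{d}\bar m^2}{\mathrm{d}\bar\varrho}$, $\bar u\bar v=\frac{\mathrm{d}\bar n^1}{\mathrm{d}\bar\varrho}$, $\bar v^2=\frac{\mathrm{d}\bar n^2}{\mathrm{d}\bar\varrho}$, $\bar E=\frac{\mathrm{d}\bar m^3}{\mathrm{d}\bar\varrho}$, $\bar E\bar v=\frac{\mathrm{d}\bar n^3}{\mathrm{d}\bar\varrho}$ (set to zero on $\bar\varrho$-null sets); (iii) on any Borel set where $\bar\varrho,\bar\wp\ll\mathcal{L}^2$, with densities $\bar\rho,\bar p$, a.e. $\bar p=\frac{\gamma-1}{2\gamma}\bar\rho(\bar E-2\bar u-\bar v^2)$, and the classical entropy condition holds at discontinuities. The Radon measure solution of Problem B considered is $\bar u=\Big(-b'(\bar x)^2+\frac{\int_0^{\bar x}b(t)b'(t)b''(t)\mathrm{d}t}{b(\bar x)}\Big)\chi_{\Gamma'}$, $\bar v=b'(\bar x)\chi_{\Gamma'}$, $\bar\varrho=\mathcal{L}^2|_{\Omega'}+\frac{b(\bar x)}{\sqrt{1+b'(\bar x)^2}}\delta_{\Gamma'}$,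 $\bar E=\bar E_\infty\chi_{\Omega'}+\bar E_\infty\chi_{\Gamma'}$ (extended to $\bar x=0$ by limits), with $\bar w_p(\bar x)=\bar p_\infty+b'(\bar x)^2+b(\bar x)b''(\bar x)$. *)

theory Defs
  imports "HOL-Analysis.Analysis" "HOL-Library.Landau_Symbols"
begin

section \<open>Measures carried by a planar domain and its boundary curve\<close>

definition domain_above :: "(real \<Rightarrow> real) \<Rightarrow> (real \<times> real) set" where
  "domain_above g = {(x, y). 0 \<le> x \<and> g x < y}"

definition graph_over :: "(real \<Rightarrow> real) \<Rightarrow> (real \<times> real) set" where
  "graph_over g = {(x, y). 0 \<le> x \<and> y = g x}"

definition add_measure :: "'a measure \<Rightarrow> 'a measure \<Rightarrow> 'a measure" where
  "add_measure M N = measure_of (space M) (sets M) (\<lambda>A. emeasure M A + emeasure N A)"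

definition area_on :: "(real \<times> real) set \<Rightarrow> (real \<times> real) measure" where
  "area_on A = density lborel (indicator A)"

text \<open>The measure sending a test function \<open>\<phi>\<close> to the integral of
  \<open>h x * \<phi> (x, g x)\<close> over \<open>x \<ge> 0\<close>, for nonnegative \<open>h\<close>; see \<open>nn_integral_graph_measure\<close>.
  The restriction to the half line makes it independent of the values of \<open>g\<close> and \<open>h\<close>
  at negative arguments.\<close>

definition graph_measure :: "(real \<Rightarrow> real) \<Rightarrow> (real \<Rightarrow> real) \<Rightarrow> (real \<times> real) measure" where
  "graph_measure h g =
     distr (density (restrict_space lborel {0..}) (\<lambda>x. ennreal (h x))) borel (\<lambda>x. (x, g x))"

text \<open>The weighted Dirac measure \<open>w \<delta>\<^sub>L\<close> on the curve \<open>L = {(x, g x). x \<ge> 0}\<close>, with \<open>g'\<close>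
  the derivative of \<open>g\<close>; for \<open>w = 1\<close> it is arc length on \<open>L\<close>.\<close>

definition weighted_dirac ::
    "(real \<Rightarrow> real) \<Rightarrow> (real \<Rightarrow> real) \<Rightarrow> (real \<Rightarrow> real) \<Rightarrow> (real \<times> real) measure" where
  "weighted_dirac w g g' = graph_measure (\<lambda>x. w x * sqrt (1 + (g' x)\<^sup>2)) g"

text \<open>Several coefficients below have the form 0/0 at \<open>x = 0\<close> and are extended there by limits.\<close>

definition ext0 :: "(real \<Rightarrow> real) \<Rightarrow> real \<Rightarrow> real" where
  "ext0 f x = (if x = 0 then Lim (at_right 0) f else f x)"

section \<open>The steady Euler flow past the wedge\<close>

text \<open>Throughout, \<open>b'\<close> and \<open>b''\<close> stand for the first two derivatives of the profile \<open>b\<close> on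
  the closed half line. The slenderness ratio is \<open>\<tau>\<close> and the Mach number is \<open>K / \<tau>\<close>, so that it
  enters only through \<open>E_inf\<close> and \<open>p_inf\<close>.\<close>

definition H :: "(real \<Rightarrow> real) \<Rightarrow> real \<Rightarrow> real \<Rightarrow> real" where
  "H b' \<tau> x = integral {0..x} (\<lambda>t. b' t / sqrt (1 + \<tau>\<^sup>2 * (b' t)\<^sup>2))"

definition E_inf :: "real \<Rightarrow> real \<Rightarrow> real \<Rightarrow> real \<Rightarrow> real" where
  "E_inf u_inf \<gamma> K \<tau> = 1/2 * u_inf\<^sup>2 * (1 + 2 * \<tau>\<^sup>2 / ((\<gamma> - 1) * K\<^sup>2))"

definition p_inf :: "real \<Rightarrow> real \<Rightarrow> real \<Rightarrow> real \<Rightarrow> real \<Rightarrow> real" where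
  "p_inf rho_inf u_inf \<gamma> K \<tau> = rho_inf * u_inf\<^sup>2 * \<tau>\<^sup>2 / (\<gamma> * K\<^sup>2)"

definition wedge_u :: "real \<Rightarrow> (real \<Rightarrow> real) \<Rightarrow> (real \<Rightarrow> real) \<Rightarrow> real \<Rightarrow> real \<times> real \<Rightarrow> real" where
  "wedge_u u_inf b b' \<tau> z =
     u_inf * indicator (domain_above (\<lambda>x. \<tau> * b x)) z
     + ext0 (\<lambda>x. u_inf * H b' \<tau> x / (b x * sqrt (1 + \<tau>\<^sup>2 * (b' x)\<^sup>2))) (fst z)
       * indicator (graph_over (\<lambda>x. \<tau> * b x)) z"

definition wedge_v :: "real \<Rightarrow> (real \<Rightarrow> real) \<Rightarrow> (real \<Rightarrow> real) \<Rightarrow> real \<Rightarrow> real \<times> real \<Rightarrow> real" where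
  "wedge_v u_inf b b' \<tau> z =
     ext0 (\<lambda>x. u_inf * \<tau> * b' x * H b' \<tau> x / (b x * sqrt (1 + \<tau>\<^sup>2 * (b' x)\<^sup>2))) (fst z)
       * indicator (graph_over (\<lambda>x. \<tau> * b x)) z"

definition wedge_E :: "real \<Rightarrow> real \<Rightarrow> real \<Rightarrow> (real \<Rightarrow> real) \<Rightarrow> real \<Rightarrow> real \<times> real \<Rightarrow> real" where
  "wedge_E u_inf \<gamma> K b \<tau> z =
     E_inf u_inf \<gamma> K \<tau> * indicator (domain_above (\<lambda>x. \<tau> * b x)) z
     + E_inf u_inf \<gamma> K \<tau> * indicator (graph_over (\<lambda>x. \<tau> * b x)) z"

definition wedge_w_rho ::
    "real \<Rightarrow> (real \<Rightarrow> real) \<Rightarrow> (real \<Rightarrow> real) \<Rightarrow> real \<Rightarrow> real \<Rightarrow> real" where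
  "wedge_w_rho rho_inf b b' \<tau> = ext0 (\<lambda>x. rho_inf * \<tau> * (b x)\<^sup>2 / H b' \<tau> x)"

definition wedge_w_p ::
    "real \<Rightarrow> real \<Rightarrow> real \<Rightarrow> real \<Rightarrow> (real \<Rightarrow> real) \<Rightarrow> (real \<Rightarrow> real) \<Rightarrow> real \<Rightarrow> real \<Rightarrow> real" where
  "wedge_w_p rho_inf u_inf \<gamma> K b' b'' \<tau> x =
     p_inf rho_inf u_inf \<gamma> K \<tau>
     + rho_inf * u_inf\<^sup>2 * \<tau>\<^sup>2 *
       ((b'' x * H b' \<tau> x + (b' x)\<^sup>2 * sqrt (1 + \<tau>\<^sup>2 * (b' x)\<^sup>2))
        / (1 + \<tau>\<^sup>2 * (b' x)\<^sup>2) powr (3/2))"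

section \<open>Scaling\<close>

text \<open>The point \<open>(x, y)\<close> of the scaled plane corresponds to \<open>(x, \<tau> * y)\<close> in the physical plane.\<close>

definition scaled_u :: "real \<Rightarrow> (real \<Rightarrow> real) \<Rightarrow> (real \<Rightarrow> real) \<Rightarrow> real \<Rightarrow> real \<times> real \<Rightarrow> real" where
  "scaled_u u_inf b b' \<tau> z = (wedge_u u_inf b b' \<tau> (fst z, \<tau> * snd z) - u_inf) / (u_inf * \<tau>\<^sup>2)"

definition scaled_v :: "real \<Rightarrow> (real \<Rightarrow> real) \<Rightarrow> (real \<Rightarrow> real) \<Rightarrow> real \<Rightarrow> real \<times> real \<Rightarrow> real" where
  "scaled_v u_inf b b' \<tau> z = wedge_v u_inf b b' \<tau> (fst z, \<tau> * snd z) / (u_inf * \<tau>)"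

definition scaled_E :: "real \<Rightarrow> real \<Rightarrow> real \<Rightarrow> (real \<Rightarrow> real) \<Rightarrow> real \<Rightarrow> real \<times> real \<Rightarrow> real" where
  "scaled_E u_inf \<gamma> K b \<tau> z =
     (2 * wedge_E u_inf \<gamma> K b \<tau> (fst z, \<tau> * snd z) - u_inf\<^sup>2) / (u_inf\<^sup>2 * \<tau>\<^sup>2)"

definition scaled_w_p ::
    "real \<Rightarrow> real \<Rightarrow> real \<Rightarrow> real \<Rightarrow> (real \<Rightarrow> real) \<Rightarrow> (real \<Rightarrow> real) \<Rightarrow> real \<Rightarrow> real \<Rightarrow> real" where
  "scaled_w_p rho_inf u_inf \<gamma> K b' b'' \<tau> x =
     wedge_w_p rho_inf u_inf \<gamma> K b' b'' \<tau> x / (\<gamma> * p_inf rho_inf u_inf \<gamma> K \<tau> * K\<^sup>2)"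

text \<open>The second summand is carried by the graph of \<open>b\<close> but its weight involves the physical
  arc length \<open>sqrt (1 + \<tau>\<^sup>2 * (b' x)\<^sup>2)\<close>, hence \<open>graph_measure\<close> and not \<open>weighted_dirac\<close>.
  Its pairing with test functions is \<open>nn_integral_scaled_mass\<close>.\<close>

definition scaled_mass ::
    "real \<Rightarrow> (real \<Rightarrow> real) \<Rightarrow> (real \<Rightarrow> real) \<Rightarrow> real \<Rightarrow> (real \<times> real) measure" where
  "scaled_mass rho_inf b b' \<tau> =
     scale_measure (ennreal \<tau>)
       (add_measure (area_on (domain_above b))
         (graph_measure
            (\<lambda>x. wedge_w_rho rho_inf b b' \<tau> x / (\<tau> * rho_inf) * sqrt (1 + \<tau>\<^sup>2 * (b' x)\<^sup>2)) b))"

section \<open>The hypersonic small-disturbance problem\<close>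

definition hsd_u ::
    "(real \<Rightarrow> real) \<Rightarrow> (real \<Rightarrow> real) \<Rightarrow> (real \<Rightarrow> real) \<Rightarrow> real \<times> real \<Rightarrow> real" where
  "hsd_u b b' b'' z =
     ext0 (\<lambda>x. - (b' x)\<^sup>2 + integral {0..x} (\<lambda>t. b t * b' t * b'' t) / b x) (fst z)
       * indicator (graph_over b) z"

definition hsd_v :: "(real \<Rightarrow> real) \<Rightarrow> (real \<Rightarrow> real) \<Rightarrow> real \<times> real \<Rightarrow> real" where
  "hsd_v b b' z = b' (fst z) * indicator (graph_over b) z"

definition hsd_E :: "real \<Rightarrow> real \<Rightarrow> (real \<Rightarrow> real) \<Rightarrow> real \<times> real \<Rightarrow> real" where
  "hsd_E \<gamma> K b z =
     2 / ((\<gamma> - 1) * K\<^sup>2) * indicator (domain_above b) z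
     + 2 / ((\<gamma> - 1) * K\<^sup>2) * indicator (graph_over b) z"

definition hsd_mass :: "(real \<Rightarrow> real) \<Rightarrow> (real \<Rightarrow> real) \<Rightarrow> (real \<times> real) measure" where
  "hsd_mass b b' =
     add_measure (area_on (domain_above b))
       (weighted_dirac (\<lambda>x. b x / sqrt (1 + (b' x)\<^sup>2)) b b')"

definition hsd_w_p ::
    "real \<Rightarrow> real \<Rightarrow> (real \<Rightarrow> real) \<Rightarrow> (real \<Rightarrow> real) \<Rightarrow> (real \<Rightarrow> real) \<Rightarrow> real \<Rightarrow> real" where
  "hsd_w_p \<gamma> K b b' b'' x = 1 / (\<gamma> * K\<^sup>2) + (b' x)\<^sup>2 + b x * b'' x"

section \<open>The reference measure and continuous versions of densities\<close>

definition ref_measure :: "(real \<Rightarrow> real) \<Rightarrow> (real \<Rightarrow> real) \<Rightarrow> (real \<times> real) measure" where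
  "ref_measure b b' = add_measure (area_on (domain_above b)) (weighted_dirac (\<lambda>_. 1) b b')"

text \<open>\<open>r\<close> represents the density of \<open>\<nu>\<close> with respect to the reference measure and is continuous on the
  domain and on its boundary curve separately. Absolute continuity is included because \<open>RN_deriv\<close>
  is zero by convention when no density exists.\<close>

definition continuous_density ::
    "(real \<Rightarrow> real) \<Rightarrow> (real \<Rightarrow> real) \<Rightarrow> (real \<times> real) measure \<Rightarrow> (real \<times> real \<Rightarrow> real) \<Rightarrow> bool" where
  "continuous_density b b' \<nu> r \<longleftrightarrow>
     absolutely_continuous (ref_measure b b') \<nu> \<and>
     (AE z in ref_measure b b'. RN_deriv (ref_measure b b') \<nu> z = ennreal (r z)) \<and>
     (\<forall>z \<in> domain_above b \<union> graph_over b. 0 \<le> r z) \<and>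
     continuous_on (domain_above b) r \<and> continuous_on (graph_over b) r"

section \<open>Pairings with test functions\<close>

lemma space_add_measure [simp]: "space (add_measure M N) = space M"
  by (simp add: add_measure_def space_measure_of_conv)

lemma sets_add_measure [simp, measurable_cong]: "sets (add_measure M N) = sets M"
  by (simp add: add_measure_def)

lemma emeasure_add_measure:
  assumes "sets N = sets M" and "A \<in> sets M"
  shows "emeasure (add_measure M N) A = emeasure M A + emeasure N A"
proof (rule emeasure_measure_of[OF add_measure_def])
  show "sets M \<subseteq> Pow (space M)" by (rule sets.space_closed)
  show "A \<in> sets (add_measure M N)" using assms by simp
  show "positive (sets (add_measure M N)) (\<lambda>A. emeasure M A + emeasure N A)"
    by (simp add: positive_def)
  show "countably_additive (sets (add_measure M N)) (\<lambda>A. emeasure M A + emeasure N A)"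
  proof (rule countably_additiveI)
    fix F :: "nat \<Rightarrow> 'a set"
    assume F: "range F \<subseteq> sets (add_measure M N)" "disjoint_family F"
    then show "(\<Sum>i. emeasure M (F i) + emeasure N (F i)) = emeasure M (\<Union>i. F i) + emeasure N (\<Union>i. F i)"
      using assms(1) by (simp add: suminf_add[symmetric] suminf_emeasure)
  qed
qed

lemma nn_integral_add_measure:
  assumes s: "sets N = sets M" and f: "f \<in> borel_measurable M"
  shows "(\<integral>\<^sup>+z. f z \<partial>add_measure M N) = (\<integral>\<^sup>+z. f z \<partial>M) + (\<integral>\<^sup>+z. f z \<partial>N)"
  using f
proof (induction rule: borel_measurable_induct)
  case (cong f g)
  moreover have "space N = space M" using s by (rule sets_eq_imp_space_eq)
  ultimately show ?case by (simp cong: nn_integral_cong_simp)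
next
  case (set A)
  with s show ?case by (simp add: emeasure_add_measure)
next
  case (mult u c)
  have [measurable]: "u \<in> borel_measurable N" using mult s by (simp cong: measurable_cong_sets)
  show ?case using mult by (simp add: nn_integral_cmult distrib_left cong: measurable_cong_sets)
next
  case (add u v)
  have [measurable]: "u \<in> borel_measurable N" "v \<in> borel_measurable N"
    using add s by (simp_all cong: measurable_cong_sets)
  show ?case using add by (simp add: nn_integral_add ac_simps cong: measurable_cong_sets)
next
  case (seq U)
  have [measurable]: "\<And>i. U i \<in> borel_measurable N" "\<And>i. U i \<in> borel_measurable M"
      "\<And>i. U i \<in> borel_measurable (add_measure M N)"
    using seq s by (simp_all cong: measurable_cong_sets)
  have mono: "incseq (\<lambda>i. integral\<^sup>N K (U i))" for K
    using \<open>incseq U\<close> by (auto simp: incseq_def le_fun_def intro!: nn_integral_mono)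
  have "(SUP i. U i) = (\<lambda>x. SUP i. U i x)"
    by (simp add: fun_eq_iff image_comp)
  then have SUP: "integral\<^sup>N K (SUP i. U i) = (SUP i. integral\<^sup>N K (U i))"
    if "\<And>i. U i \<in> borel_measurable K" for K
    using nn_integral_monotone_convergence_SUP[OF \<open>incseq U\<close> that] by (simp only:)
  have "(SUP i. integral\<^sup>N (add_measure M N) (U i))
      = (SUP i. integral\<^sup>N M (U i)) + (SUP i. integral\<^sup>N N (U i))"
    unfolding seq.IH by (rule ennreal_SUP_add[OF mono mono])
  moreover have "U i \<in> borel_measurable M" "U i \<in> borel_measurable N"
      "U i \<in> borel_measurable (add_measure M N)" for i
    by measurable
  ultimately show ?case by (simp only: SUP)
qed

lemma nn_integral_area_on:
  assumes "A \<in> sets borel" and "\<phi> \<in> borel_measurable borel"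
  shows "(\<integral>\<^sup>+z. \<phi> z \<partial>area_on A) = (\<integral>\<^sup>+z\<in>A. \<phi> z \<partial>lborel)"
  unfolding area_on_def using assms by (subst nn_integral_density) (auto simp: mult.commute)

lemma sets_area_on [simp, measurable_cong]: "sets (area_on A) = sets borel"
  by (simp add: area_on_def)

lemma sets_graph_measure [simp, measurable_cong]: "sets (graph_measure h g) = sets borel"
  by (simp add: graph_measure_def)

lemma nn_integral_graph_measure:
  assumes h: "h \<in> borel_measurable (restrict_space borel {0..})"
    and g: "g \<in> borel_measurable (restrict_space borel {0..})"
    and \<phi>: "\<phi> \<in> borel_measurable borel"
  shows "(\<integral>\<^sup>+z. \<phi> z \<partial>graph_measure h g) = (\<integral>\<^sup>+x\<in>{0..}. ennreal (h x) * \<phi> (x, g x) \<partial>lborel)"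
proof -
  let ?R = "restrict_space lborel {0..} :: real measure"
  have sets: "sets ?R = sets (restrict_space borel {0..})"
    by (simp add: sets_restrict_space)
  have [measurable]: "h \<in> borel_measurable ?R" "g \<in> borel_measurable ?R"
    using h g by (simp_all cong: measurable_cong_sets add: measurable_cong_sets[OF sets refl])
  have [measurable]: "(\<lambda>x. x) \<in> borel_measurable ?R"
    by (rule measurable_restrict_space1) simp
  have graph: "(\<lambda>x. (x, g x)) \<in> measurable ?R borel"
    by (rule borel_measurable_Pair) measurable
  have "(\<integral>\<^sup>+z. \<phi> z \<partial>graph_measure h g)
      = (\<integral>\<^sup>+x. \<phi> (x, g x) \<partial>density ?R (\<lambda>x. ennreal (h x)))"
    unfolding graph_measure_def using graph \<phi> by (subst nn_integral_distr) auto
  also have "\<dots> = (\<integral>\<^sup>+x. ennreal (h x) * \<phi> (x, g x) \<partial>?R)"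
    using measurable_compose[OF graph \<phi>] by (subst nn_integral_density) auto
  also have "\<dots> = (\<integral>\<^sup>+x\<in>{0..}. ennreal (h x) * \<phi> (x, g x) \<partial>lborel)"
    by (subst nn_integral_restrict_space) auto
  finally show ?thesis .
qed

lemma nn_integral_scaled_mass:
  assumes "\<tau> > 0"
    and b: "continuous_on {0..} b" and b': "continuous_on {0..} b'"
    and \<phi>: "\<phi> \<in> borel_measurable borel"
  shows "(\<integral>\<^sup>+z. \<phi> z \<partial>scaled_mass rho_inf b b' \<tau>)
    = ennreal \<tau> * ((\<integral>\<^sup>+z\<in>domain_above b. \<phi> z \<partial>lborel)
        + (\<integral>\<^sup>+x\<in>{0..}. ennreal (wedge_w_rho rho_inf b b' \<tau> x / (\<tau> * rho_inf)
             * sqrt (1 + \<tau>\<^sup>2 * (b' x)\<^sup>2)) * \<phi> (x, b x) \<partial>lborel))"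
proof -
  let ?B = "restrict_space borel {0..} :: real measure"
  have [measurable]: "b \<in> borel_measurable ?B" "b' \<in> borel_measurable ?B"
    using b b' by (auto intro: borel_measurable_continuous_on_restrict)
  have H: "continuous_on {0..} (H b' \<tau>)"
    unfolding continuous_on_eq_continuous_within
  proof
    fix x :: real assume "x \<in> {0..}"
    then have x: "0 \<le> x" by simp
    have "continuous_on {0..x + 1} (\<lambda>t. b' t / sqrt (1 + \<tau>\<^sup>2 * (b' t)\<^sup>2))"
      using continuous_on_subset[OF b']
      by (intro continuous_intros) (auto simp: add_nonneg_eq_0_iff)
    then have "continuous_on {0..x + 1} (H b' \<tau>)"
      unfolding H_def by (intro indefinite_integral_continuous_1 integrable_continuous_real)
    then have "continuous (at x within {0..x + 1}) (H b' \<tau>)"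
      using x by (simp add: continuous_on_eq_continuous_within)
    moreover have "at x within {0..} = at x within {0..x + 1}"
      by (rule at_within_nhd[where S = "{..<x + 1}"]) auto
    ultimately show "continuous (at x within {0..}) (H b' \<tau>)" by simp
  qed
  then have [measurable]: "H b' \<tau> \<in> borel_measurable ?B"
    by (rule borel_measurable_continuous_on_restrict)
  have [measurable]: "(\<lambda>x. x) \<in> borel_measurable ?B"
    by (rule measurable_restrict_space1) simp
  have w: "wedge_w_rho rho_inf b b' \<tau> \<in> borel_measurable ?B"
    unfolding wedge_w_rho_def ext0_def by measurable
  then have h: "(\<lambda>x. wedge_w_rho rho_inf b b' \<tau> x / (\<tau> * rho_inf) * sqrt (1 + \<tau>\<^sup>2 * (b' x)\<^sup>2))
      \<in> borel_measurable ?B"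
    by measurable
  have "(\<lambda>x. indicator {0..} x *\<^sub>R b x) \<in> borel_measurable borel"
    using b by (intro borel_measurable_continuous_on_indicator) auto
  then have "(\<lambda>z. indicator {0..} (fst z) *\<^sub>R b (fst z)) \<in> borel_measurable (borel \<Otimes>\<^sub>M (borel :: real measure))"
    by (rule measurable_compose[OF measurable_fst])
  then have [measurable]: "(\<lambda>z :: real \<times> real. indicator {0..} (fst z) *\<^sub>R b (fst z)) \<in> borel_measurable borel"
    unfolding borel_prod .
  have [measurable]: "(fst :: real \<times> real \<Rightarrow> real) \<in> borel_measurable borel"
      "(snd :: real \<times> real \<Rightarrow> real) \<in> borel_measurable borel"
    by (rule borel_measurable_continuous_onI, rule continuous_on_fst continuous_on_snd,
        rule continuous_on_id)+
  have "domain_above b = {z \<in> space borel. 0 \<le> fst z \<and> indicator {0..} (fst z) *\<^sub>R b (fst z) < snd z}"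
    by (auto simp: domain_above_def)
  also have "\<dots> \<in> sets borel"
    by (intro borel_measurable_le borel_measurable_less sets.sets_Collect_conj) measurable
  finally have "domain_above b \<in> sets borel" .
  with h \<phi> show ?thesis
    unfolding scaled_mass_def
    by (simp add: nn_integral_scale_measure nn_integral_add_measure nn_integral_area_on
        nn_integral_graph_measure cong: measurable_cong_sets)
qed

end

theory Submission
  imports Defs
begin

text \<open>
  The reference measure does not charge the axis \<open>x = 0\<close>, so for the almost everywhere claims it
  suffices to take limits at each point with \<open>x > 0\<close>. Above the boundary curve the scaled
  quantities already equal their small-disturbance counterparts, up to the factor \<open>\<tau>\<close> of the mass, so only the curve matters.

  Write \<open>s = sqrt (1 + \<tau>\<^sup>2 * (b')\<^sup>2)\<close>. Since \<open>1 / s = 1 - \<tau>\<^sup>2 * (b')\<^sup>2 / (s * (1 + s))\<close>, integration gives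
  the exact identity \<open>H b' \<tau> x = b x - \<tau>\<^sup>2 * H_defect \<tau> x\<close> (\<open>H_eq\<close>), where \<open>H_defect \<tau> x\<close> is the
  integral of \<open>(b')\<^sup>3 / (s * (1 + s))\<close> over \<open>[0, x]\<close>. This integral depends continuously on the
  parameter \<open>\<tau>\<close>, so it tends to half the integral of \<open>(b')\<^sup>3\<close> (\<open>tendsto_H_defect\<close>). The limits of
  \<open>v\<close>, of the pressure coefficient and of the density only use \<open>H b' \<tau> x \<rightarrow> b x\<close>. For \<open>u\<close>, which is
  divided by \<open>\<tau>\<^sup>2\<close>, the coefficient of \<open>\<tau>\<^sup>2\<close> is needed: the limit is
  \<open>- (b')\<^sup>2 / 2\<close> minus half the integral of \<open>(b')\<^sup>3\<close> divided by \<open>b\<close>, and an integration by parts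
  (\<open>integral_b_b'_b''\<close>) brings it to the stated form. The scaled \<open>E\<close> is equal to its limit.

  For the mass, explicit continuous densities are exhibited; on the curve they are
  \<open>\<tau> * b\<^sup>2 * s / (H * sqrt (1 + (b')\<^sup>2))\<close> and \<open>b / sqrt (1 + (b')\<^sup>2)\<close>. The remaining point is that
  arbitrary continuous versions are considered, one for each \<open>\<tau>\<close>. For each \<open>\<tau>\<close> they
  agree with the explicit ones almost everywhere, and an uncountable union of null sets would be of
  no use; but two continuous versions agree at every point of the
  domain and of the curve off the axis (\<open>continuous_density_unique\<close>), because a continuous function vanishing Lebesgue-almost everywhere
  on an open set vanishes on it.
\<close>

section \<open>Preliminaries\<close>

lemma smallo_1I: "(f \<longlongrightarrow> l) F \<Longrightarrow> (\<lambda>t. f t - l) \<in> o[F](\<lambda>_. 1)" for f :: "real \<Rightarrow> real"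
  by (rule smalloI_tendsto) (auto simp: LIM_zero)

lemma scaled_point_mem:
  assumes "\<tau> > 0"
  shows "(x, \<tau> * y) \<in> domain_above (\<lambda>x. \<tau> * b x) \<longleftrightarrow> (x, y) \<in> domain_above b"
    and "(x, \<tau> * y) \<in> graph_over (\<lambda>x. \<tau> * b x) \<longleftrightarrow> (x, y) \<in> graph_over b"
  using assms by (auto simp: domain_above_def graph_over_def)

text \<open>The energy is constant up to the boundary, so no limit is involved.\<close>

lemma scaled_E_eq:
  assumes "u_inf > 0" "\<tau> > 0" and z: "z \<in> domain_above b \<union> graph_over b"
  shows "scaled_E u_inf \<gamma> K b \<tau> z = hsd_E \<gamma> K b z"
proof -
  obtain x y where xy: "z = (x, y)" by force
  have "(indicator (domain_above b) z :: real) + indicator (graph_over b) z = 1"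
    using z by (auto simp: indicator_def domain_above_def graph_over_def)
  moreover have "wedge_E u_inf \<gamma> K b \<tau> (x, \<tau> * y)
      = E_inf u_inf \<gamma> K \<tau> * (indicator (domain_above b) z + indicator (graph_over b) z)"
    using assms by (simp add: wedge_E_def xy scaled_point_mem indicator_def distrib_left)
  moreover have "hsd_E \<gamma> K b z
      = 2 / ((\<gamma> - 1) * K\<^sup>2) * (indicator (domain_above b) z + indicator (graph_over b) z)"
    by (simp add: hsd_E_def distrib_left)
  moreover have "2 * E_inf u_inf \<gamma> K \<tau> - u_inf\<^sup>2 = u_inf\<^sup>2 * \<tau>\<^sup>2 * (2 / ((\<gamma> - 1) * K\<^sup>2))"
    by (simp add: E_inf_def algebra_simps)
  ultimately show ?thesis
    using assms by (simp add: scaled_E_def xy)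
qed

text \<open>Extending by the value at 0 makes functions on the half line continuous on the whole plane.\<close>

lemma cont_extend:
  fixes f :: "real \<Rightarrow> real"
  assumes "continuous_on {0..} f"
  shows "continuous_on UNIV (\<lambda>z :: real \<times> real. f (max 0 (fst z)))"
  by (rule continuous_on_compose2[OF assms], intro continuous_intros) auto

lemma borel_fst_snd [measurable]:
  "(fst :: real \<times> real \<Rightarrow> real) \<in> borel_measurable borel"
  "(snd :: real \<times> real \<Rightarrow> real) \<in> borel_measurable borel"
  by (intro borel_measurable_continuous_onI continuous_intros)+

lemma borel_on_half_line:
  fixes f :: "real \<Rightarrow> real"
  assumes "continuous_on {0..} f"
  shows "f \<in> borel_measurable (restrict_space borel {0..})"
  using assms by (rule borel_measurable_continuous_on_restrict)

lemma AE_eq_imp_eq_on_open: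
  fixes f g :: "'a::euclidean_space \<Rightarrow> real"
  assumes "open S" "continuous_on S f" "continuous_on S g"
    and ae: "AE x in lborel. x \<in> S \<longrightarrow> f x = g x" and "x \<in> S"
  shows "f x = g x"
proof (rule ccontr)
  let ?U = "{x \<in> S. f x - g x \<noteq> 0}"
  assume "f x \<noteq> g x"
  have "?U = S \<inter> (\<lambda>x. f x - g x) -` (- {0})" by auto
  moreover have "open (S \<inter> (\<lambda>x. f x - g x) -` (- {0}))"
    using assms by (intro continuous_open_preimage continuous_intros) auto
  ultimately have op: "open ?U" by simp
  have "AE x\<in>?U in lebesgue. x \<in> {}"
    using AE_completion[OF ae] by (rule eventually_mono) auto
  from mem_closed_if_AE_lebesgue_open[OF op closed_empty this, of x] show False
    using \<open>f x \<noteq> g x\<close> \<open>x \<in> S\<close> by simp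
qed

section \<open>The wedge profile and the expansion of H\<close>

text \<open>The profile is only constrained on the closed half line, so its derivatives are taken within
  \<open>{0..}\<close>, one-sided at the tip.\<close>

locale wedge_profile =
  fixes b b' b'' :: "real \<Rightarrow> real"
  assumes deriv_b: "\<And>x. x \<ge> 0 \<Longrightarrow> (b has_real_derivative b' x) (at x within {0..})"
    and deriv_b': "\<And>x. x \<ge> 0 \<Longrightarrow> (b' has_real_derivative b'' x) (at x within {0..})"
    and cont_b'': "continuous_on {0..} b''"
    and b_0 [simp]: "b 0 = 0"
    and b'_pos: "\<And>x. x \<ge> 0 \<Longrightarrow> b' x > 0"
begin

lemma cont_b: "continuous_on {0..} b"
  using deriv_b by (auto simp: continuous_on_eq_continuous_within intro: DERIV_continuous)

lemma cont_b': "continuous_on {0..} b'"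
  using deriv_b' by (auto simp: continuous_on_eq_continuous_within intro: DERIV_continuous)

text \<open>The ratio of arc length along the physical boundary \<open>y = \<tau> * b x\<close> to \<open>dx\<close>. At \<open>\<tau> = 1\<close> it is
  the arc length factor of the scaled boundary, that is, the weight of the reference measure there.\<close>

definition stretch :: "real \<Rightarrow> real \<Rightarrow> real" where
  "stretch \<tau> x = sqrt (1 + \<tau>\<^sup>2 * (b' x)\<^sup>2)"

lemma stretch_ge_1: "1 \<le> stretch \<tau> x"
  by (simp add: stretch_def)

lemma stretch_pos [simp]: "0 < stretch \<tau> x"
  using stretch_ge_1[of \<tau> x] by linarith

lemma stretch_nonzero [simp]: "stretch \<tau> x \<noteq> 0" "\<not> stretch \<tau> x \<le> 0" "1 + stretch \<tau> x \<noteq> 0"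
  using stretch_ge_1[of \<tau> x] by linarith+

lemma stretch_0 [simp]: "stretch 0 x = 1"
  by (simp add: stretch_def)

lemma stretch_sq: "(stretch \<tau> x)\<^sup>2 = 1 + \<tau>\<^sup>2 * (b' x)\<^sup>2"
  by (simp add: stretch_def)

text \<open>An exact form of the expansion \<open>1 / stretch \<tau> x = 1 - \<tau>\<^sup>2 * (b' x)\<^sup>2 / 2 + O(\<tau>\<^sup>4)\<close>: the
  coefficient of \<open>\<tau>\<^sup>2\<close> still depends on \<open>\<tau>\<close>, but continuously.\<close>

lemma inverse_stretch: "1 / stretch \<tau> x = 1 - \<tau>\<^sup>2 * ((b' x)\<^sup>2 / (stretch \<tau> x * (1 + stretch \<tau> x)))"
proof -
  have "\<tau>\<^sup>2 * (b' x)\<^sup>2 = (stretch \<tau> x - 1) * (1 + stretch \<tau> x)"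
    using stretch_sq[of \<tau> x] by (simp add: algebra_simps power2_eq_square)
  then have "\<tau>\<^sup>2 * ((b' x)\<^sup>2 / (stretch \<tau> x * (1 + stretch \<tau> x))) = (stretch \<tau> x - 1) / stretch \<tau> x"
    unfolding times_divide_eq_right by simp
  then show ?thesis by (simp add: diff_divide_distrib)
qed

lemma cont_stretch: "continuous_on {0..} (stretch \<tau>)"
  unfolding stretch_def by (intro continuous_intros cont_b')

lemma tendsto_stretch: "((\<lambda>\<tau>. stretch \<tau> x) \<longlongrightarrow> 1) (at_right 0)"
  unfolding stretch_def by (rule tendsto_eq_intros refl | simp)+

text \<open>The difference \<open>b x - H b' \<tau> x\<close> divided by \<open>\<tau>\<^sup>2\<close>, see \<open>H_eq\<close>; the formula makes sense at
  \<open>\<tau> = 0\<close> as well.\<close>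

definition H_defect :: "real \<Rightarrow> real \<Rightarrow> real" where
  "H_defect \<tau> x = integral {0..x} (\<lambda>t. b' t ^ 3 / (stretch \<tau> t * (1 + stretch \<tau> t)))"

lemma integral_b':
  assumes "x \<ge> 0"
  shows "integral {0..x} b' = b x"
proof -
  have "(b' has_integral b x - b 0) {0..x}"
    using assms
    by (intro fundamental_theorem_of_calculus)
       (auto intro: DERIV_subset[OF deriv_b] simp flip: has_real_derivative_iff_has_vector_derivative)
  then show ?thesis by (simp add: integral_unique)
qed

lemma H_eq:
  assumes "x \<ge> 0"
  shows "H b' \<tau> x = b x - \<tau>\<^sup>2 * H_defect \<tau> x"
proof -
  have sub: "{0..x} \<subseteq> {0..}" by auto
  note c = continuous_on_subset[OF cont_b' sub] continuous_on_subset[OF cont_stretch sub]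
  have "b' t / stretch \<tau> t = b' t - \<tau>\<^sup>2 * (b' t ^ 3 / (stretch \<tau> t * (1 + stretch \<tau> t)))" for t
  proof -
    have "b' t / stretch \<tau> t = b' t * (1 / stretch \<tau> t)" by simp
    also have "\<dots> = b' t - \<tau>\<^sup>2 * (b' t ^ 3 / (stretch \<tau> t * (1 + stretch \<tau> t)))"
      unfolding inverse_stretch by (simp add: right_diff_distrib power3_eq_cube power2_eq_square)
    finally show ?thesis .
  qed
  then have "H b' \<tau> x = integral {0..x} (\<lambda>t. b' t - \<tau>\<^sup>2 * (b' t ^ 3 / (stretch \<tau> t * (1 + stretch \<tau> t))))"
    by (simp add: H_def stretch_def)
  also have "\<dots> = integral {0..x} b'
      - integral {0..x} (\<lambda>t. \<tau>\<^sup>2 * (b' t ^ 3 / (stretch \<tau> t * (1 + stretch \<tau> t))))"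
    by (intro integral_diff integrable_continuous_real continuous_intros c) auto
  also have "\<dots> = b x - \<tau>\<^sup>2 * H_defect \<tau> x"
    unfolding H_defect_def integral_b'[OF assms] by (subst integral_mult_right) simp
  finally show ?thesis .
qed

lemma tendsto_H_defect:
  assumes "x \<ge> 0"
  shows "((\<lambda>\<tau>. H_defect \<tau> x) \<longlongrightarrow> integral {0..x} (\<lambda>t. b' t ^ 3) / 2) (at_right 0)"
proof -
  \<comment> \<open>an integral over a compact interval depends continuously on a parameter\<close>
  have "continuous_on (UNIV \<times> cbox 0 x)
      (\<lambda>(\<tau>, t). b' t ^ 3 / (stretch \<tau> t * (1 + stretch \<tau> t)))"
  proof -
    have "continuous_on (UNIV \<times> cbox 0 x) (\<lambda>z :: real \<times> real. b' (snd z))"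
      by (rule continuous_on_compose2[OF cont_b'], intro continuous_intros) auto
    then show ?thesis
      unfolding split_beta stretch_def
      by (intro continuous_intros) (auto simp flip: stretch_def)
  qed
  then have "continuous_on UNIV (\<lambda>\<tau>. H_defect \<tau> x)"
    using integral_continuous_on_param[of UNIV 0 x
        "\<lambda>\<tau> t. b' t ^ 3 / (stretch \<tau> t * (1 + stretch \<tau> t))"]
    by (simp add: H_defect_def)
  then have "((\<lambda>\<tau>. H_defect \<tau> x) \<longlongrightarrow> H_defect 0 x) (at_right 0)"
    unfolding continuous_on_def by (blast intro: tendsto_within_subset)
  then show ?thesis by (simp add: H_defect_def)
qed

lemma tendsto_H:
  assumes "x \<ge> 0"
  shows "((\<lambda>\<tau>. H b' \<tau> x) \<longlongrightarrow> b x) (at_right 0)"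
  unfolding H_eq[OF assms] by (rule tendsto_eq_intros tendsto_H_defect assms refl | simp)+

lemma H_0 [simp]: "H b' \<tau> 0 = 0"
  by (simp add: H_def)

lemma H_pos:
  assumes "x > 0"
  shows "H b' \<tau> x > 0"
proof -
  have sub: "{0..x} \<subseteq> {0..}" by auto
  have "integral {0..x} (\<lambda>_. 0) < integral {0..x} (\<lambda>t. b' t / stretch \<tau> t)"
    using assms b'_pos
    by (intro integral_less_real continuous_intros continuous_on_subset[OF cont_b' sub]
        continuous_on_subset[OF cont_stretch sub]) auto
  then show ?thesis by (simp add: H_def stretch_def)
qed

lemma b_eq_H: "x \<ge> 0 \<Longrightarrow> b x = H b' 0 x"
  by (simp add: H_eq)

lemma b_pos: "x > 0 \<Longrightarrow> b x > 0"
  using H_pos[of x 0] by (simp add: b_eq_H)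

lemma has_derivative_H:
  assumes "x \<ge> 0"
  shows "(H b' \<tau> has_real_derivative b' x / stretch \<tau> x) (at x within {0..})"
proof -
  have sub: "{0..x + 1} \<subseteq> {0..}" by auto
  have "continuous_on {0..x + 1} (\<lambda>t. b' t / stretch \<tau> t)"
    by (intro continuous_intros continuous_on_subset[OF cont_b' sub]
        continuous_on_subset[OF cont_stretch sub]) auto
  then have "(H b' \<tau> has_real_derivative b' x / stretch \<tau> x) (at x within {0..x + 1})"
    unfolding H_def stretch_def[symmetric]
    using assms by (intro integral_has_real_derivative) auto
  moreover have "at x within {0..} = at x within {0..x + 1}"
    by (rule at_within_nhd[where S = "{..<x + 1}"]) auto
  ultimately show ?thesis by simp
qed

lemma cont_H: "continuous_on {0..} (H b' \<tau>)"
  using has_derivative_H by (auto simp: continuous_on_eq_continuous_within intro: DERIV_continuous)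

text \<open>Numerator and denominator both vanish at the tip, with one-sided derivatives \<open>b' 0\<close> and
  \<open>b' 0 / stretch \<tau> 0\<close>.\<close>

lemma tendsto_b_over_H: "((\<lambda>x. b x / H b' \<tau> x) \<longlongrightarrow> stretch \<tau> 0) (at_right 0)"
proof -
  have D: "((\<lambda>x. f x / x) \<longlongrightarrow> d) (at_right 0)"
    if "(f has_real_derivative d) (at 0 within {0..})" "f 0 = 0" for f :: "real \<Rightarrow> real" and d
  proof -
    have "((\<lambda>x. f x / x) \<longlongrightarrow> d) (at 0 within {0..})"
      using that by (simp add: has_field_derivative_iff)
    then show ?thesis by (rule tendsto_within_subset) auto
  qed
  have "((\<lambda>x. (b x / x) / (H b' \<tau> x / x)) \<longlongrightarrow> b' 0 / (b' 0 / stretch \<tau> 0)) (at_right 0)"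
    using b'_pos[of 0] by (intro tendsto_divide D deriv_b has_derivative_H) auto
  moreover have "\<forall>\<^sub>F x in at_right 0. (b x / x) / (H b' \<tau> x / x) = b x / H b' \<tau> x"
    by (auto simp: eventually_at_filter)
  ultimately have "((\<lambda>x. b x / H b' \<tau> x) \<longlongrightarrow> b' 0 / (b' 0 / stretch \<tau> 0)) (at_right 0)"
    by (rule Lim_transform_eventually)
  then show ?thesis
    using b'_pos[of 0] by simp
qed

text \<open>At the tip the quotient is \<open>0 / 0 = 0\<close> by convention, which is also its limit there.\<close>

lemma cont_b_sq_over_H: "continuous_on {0..} (\<lambda>x. (b x)\<^sup>2 / H b' \<tau> x)"
proof -
  have 0: "((\<lambda>x. (b x)\<^sup>2 / H b' \<tau> x) \<longlongrightarrow> 0) (at_right 0)"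
  proof -
    have "(b \<longlongrightarrow> b 0) (at 0 within {0..})"
      using cont_b unfolding continuous_on_def by blast
    then have "(b \<longlongrightarrow> 0) (at_right 0)"
      unfolding b_0 by (rule tendsto_within_subset) auto
    from tendsto_mult[OF this tendsto_b_over_H[of \<tau>]] show ?thesis
      by (simp add: power2_eq_square)
  qed
  have "continuous (at x within {0..}) (\<lambda>x. (b x)\<^sup>2 / H b' \<tau> x)" if "x \<ge> 0" for x
  proof (cases "x = 0")
    case True
    have "at 0 within {0..} = (at_right 0 :: real filter)"
      by (rule at_within_nhd[where S = UNIV]) auto
    then show ?thesis using True 0 by (simp add: continuous_within)
  next
    case False
    with that H_pos[of x \<tau>] cont_b cont_H show ?thesis
      by (intro continuous_intros) (auto simp: continuous_on_eq_continuous_within)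
  qed
  then show ?thesis by (auto simp: continuous_on_eq_continuous_within)
qed

text \<open>Integration by parts with \<open>b' * b'' = ((b')\<^sup>2 / 2)'\<close>. This turns the integral in the
  small-disturbance velocity into the integral of \<open>(b')\<^sup>3\<close> that \<open>H_defect\<close> produces.\<close>

lemma integral_b_b'_b'':
  assumes "x \<ge> 0"
  shows "integral {0..x} (\<lambda>t. b t * b' t * b'' t)
    = b x * (b' x)\<^sup>2 / 2 - integral {0..x} (\<lambda>t. b' t ^ 3) / 2"
proof -
  have sub: "{0..x} \<subseteq> {0..}" by auto
  have "((\<lambda>t. b t * (b' t)\<^sup>2 / 2) has_real_derivative b t * b' t * b'' t + b' t ^ 3 / 2)
      (at t within {0..x})" if "t \<in> {0..x}" for t
    using that
    by (auto intro!: derivative_eq_intros DERIV_subset[OF deriv_b] DERIV_subset[OF deriv_b']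
        simp: power3_eq_cube power2_eq_square field_simps)
  then have "((\<lambda>t. b t * b' t * b'' t + b' t ^ 3 / 2) has_integral
      b x * (b' x)\<^sup>2 / 2 - b 0 * (b' 0)\<^sup>2 / 2) {0..x}"
    using assms
    by (intro fundamental_theorem_of_calculus)
       (auto simp flip: has_real_derivative_iff_has_vector_derivative)
  then have "integral {0..x} (\<lambda>t. b t * b' t * b'' t + b' t ^ 3 / 2) = b x * (b' x)\<^sup>2 / 2"
    by (simp add: integral_unique)
  moreover have "integral {0..x} (\<lambda>t. b t * b' t * b'' t + b' t ^ 3 / 2)
      = integral {0..x} (\<lambda>t. b t * b' t * b'' t) + integral {0..x} (\<lambda>t. b' t ^ 3 / 2)"
    by (intro integral_add integrable_continuous_real continuous_intros
        continuous_on_subset[OF cont_b sub] continuous_on_subset[OF cont_b' sub]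
        continuous_on_subset[OF cont_b'' sub]) auto
  ultimately show ?thesis by simp
qed

section \<open>Limits of the velocity and the pressure coefficient\<close>

lemma tendsto_scaled_u_curve:
  assumes x: "x > 0"
  shows "((\<lambda>\<tau>. (H b' \<tau> x / (b x * stretch \<tau> x) - 1) / \<tau>\<^sup>2)
    \<longlongrightarrow> - (b' x)\<^sup>2 + integral {0..x} (\<lambda>t. b t * b' t * b'' t) / b x) (at_right 0)"
proof -
  let ?I = "integral {0..x} (\<lambda>t. b' t ^ 3)"
  have bx: "b x \<noteq> 0" using b_pos[OF x] by simp
  have "(H b' \<tau> x / (b x * stretch \<tau> x) - 1) / \<tau>\<^sup>2
      = - (b' x)\<^sup>2 / (stretch \<tau> x * (1 + stretch \<tau> x)) - H_defect \<tau> x / (b x * stretch \<tau> x)"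
    if "\<tau> > 0" for \<tau>
  proof -
    have "H b' \<tau> x / (b x * stretch \<tau> x) - 1
        = (1 / stretch \<tau> x - 1) - \<tau>\<^sup>2 * (H_defect \<tau> x / (b x * stretch \<tau> x))"
      using x bx by (simp add: H_eq field_simps)
    also have "\<dots> = \<tau>\<^sup>2 * (- (b' x)\<^sup>2 / (stretch \<tau> x * (1 + stretch \<tau> x))
        - H_defect \<tau> x / (b x * stretch \<tau> x))"
      unfolding inverse_stretch by (simp add: right_diff_distrib)
    finally show ?thesis using that by simp
  qed
  then have "\<forall>\<^sub>F \<tau> in at_right 0. - (b' x)\<^sup>2 / (stretch \<tau> x * (1 + stretch \<tau> x))
        - H_defect \<tau> x / (b x * stretch \<tau> x) = (H b' \<tau> x / (b x * stretch \<tau> x) - 1) / \<tau>\<^sup>2"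
    by (auto simp: eventually_at_filter)
  moreover have "((\<lambda>\<tau>. - (b' x)\<^sup>2 / (stretch \<tau> x * (1 + stretch \<tau> x))
        - H_defect \<tau> x / (b x * stretch \<tau> x))
      \<longlongrightarrow> - (b' x)\<^sup>2 / (1 * (1 + 1)) - (?I / 2) / (b x * 1)) (at_right 0)"
    using x bx by (intro tendsto_intros tendsto_stretch tendsto_H_defect) auto
  ultimately have "((\<lambda>\<tau>. (H b' \<tau> x / (b x * stretch \<tau> x) - 1) / \<tau>\<^sup>2)
      \<longlongrightarrow> - (b' x)\<^sup>2 / (1 * (1 + 1)) - (?I / 2) / (b x * 1)) (at_right 0)"
    by (rule Lim_transform_eventually[rotated])
  also have "- (b' x)\<^sup>2 / (1 * (1 + 1)) - (?I / 2) / (b x * 1)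
      = - (b' x)\<^sup>2 + integral {0..x} (\<lambda>t. b t * b' t * b'' t) / b x"
    unfolding integral_b_b'_b''[OF less_imp_le[OF x]] using bx by (simp add: field_simps)
  finally show ?thesis .
qed

lemma scaled_u_smallo:
  assumes "u_inf > 0" and z: "z \<in> domain_above b \<union> graph_over b" and "fst z \<noteq> 0"
  shows "(\<lambda>\<tau>. scaled_u u_inf b b' \<tau> z - hsd_u b b' b'' z) \<in> o[at_right 0](\<lambda>_. 1)"
proof (rule smallo_1I)
  obtain x y where xy: "z = (x, y)" by force
  then have x: "x > 0" using assms(2,3) by (auto simp: domain_above_def graph_over_def)
  show "((\<lambda>\<tau>. scaled_u u_inf b b' \<tau> z) \<longlongrightarrow> hsd_u b b' b'' z) (at_right 0)"
  proof (cases "z \<in> graph_over b")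
    case True
    then have "z \<notin> domain_above b" by (auto simp: domain_above_def graph_over_def)
    with True have "\<forall>\<^sub>F \<tau> in at_right 0.
        (H b' \<tau> x / (b x * stretch \<tau> x) - 1) / \<tau>\<^sup>2 = scaled_u u_inf b b' \<tau> z"
      using x \<open>u_inf > 0\<close>
      by (auto simp: eventually_at_filter xy scaled_u_def wedge_u_def scaled_point_mem ext0_def
          stretch_def[symmetric] field_simps)
    moreover have "hsd_u b b' b'' z = - (b' x)\<^sup>2 + integral {0..x} (\<lambda>t. b t * b' t * b'' t) / b x"
      using True x by (simp add: hsd_u_def xy ext0_def)
    ultimately show ?thesis
      using tendsto_scaled_u_curve[OF x] by (simp add: filterlim_cong Lim_transform_eventually)
  next
    case False
    with z have "z \<in> domain_above b" by simp
    with False have "\<forall>\<^sub>F \<tau> in at_right 0. 0 = scaled_u u_inf b b' \<tau> z"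
      by (auto simp: eventually_at_filter xy scaled_u_def wedge_u_def scaled_point_mem)
    then have "((\<lambda>\<tau>. scaled_u u_inf b b' \<tau> z) \<longlongrightarrow> 0) (at_right 0)"
      by (rule Lim_transform_eventually[OF tendsto_const])
    with False show ?thesis by (simp add: hsd_u_def)
  qed
qed

lemma scaled_v_smallo:
  assumes "u_inf > 0" and z: "z \<in> domain_above b \<union> graph_over b" and "fst z \<noteq> 0"
  shows "(\<lambda>\<tau>. scaled_v u_inf b b' \<tau> z - hsd_v b b' z) \<in> o[at_right 0](\<lambda>_. 1)"
proof (rule smallo_1I)
  obtain x y where xy: "z = (x, y)" by force
  then have x: "x > 0" using assms(2,3) by (auto simp: domain_above_def graph_over_def)
  have bx: "b x \<noteq> 0" using b_pos[OF x] by simp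
  show "((\<lambda>\<tau>. scaled_v u_inf b b' \<tau> z) \<longlongrightarrow> hsd_v b b' z) (at_right 0)"
  proof (cases "z \<in> graph_over b")
    case True
    have "((\<lambda>\<tau>. b' x * H b' \<tau> x / (b x * stretch \<tau> x)) \<longlongrightarrow> b' x * b x / (b x * 1)) (at_right 0)"
      using x bx by (intro tendsto_intros tendsto_H tendsto_stretch) auto
    moreover have "\<forall>\<^sub>F \<tau> in at_right 0.
        b' x * H b' \<tau> x / (b x * stretch \<tau> x) = scaled_v u_inf b b' \<tau> z"
      using True x \<open>u_inf > 0\<close>
      by (auto simp: eventually_at_filter xy scaled_v_def wedge_v_def scaled_point_mem ext0_def
          stretch_def[symmetric] field_simps)
    ultimately show ?thesis
      using True bx by (simp add: hsd_v_def xy Lim_transform_eventually)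
  next
    case False
    then have "\<forall>\<^sub>F \<tau> in at_right 0. 0 = scaled_v u_inf b b' \<tau> z"
      by (auto simp: eventually_at_filter xy scaled_v_def wedge_v_def scaled_point_mem)
    then have "((\<lambda>\<tau>. scaled_v u_inf b b' \<tau> z) \<longlongrightarrow> 0) (at_right 0)"
      by (rule Lim_transform_eventually[OF tendsto_const])
    with False show ?thesis by (simp add: hsd_v_def)
  qed
qed

lemma scaled_w_p_smallo:
  assumes "\<gamma> > 0" "K > 0" "rho_inf > 0" "u_inf > 0" and x: "x \<ge> 0"
  shows "(\<lambda>\<tau>. scaled_w_p rho_inf u_inf \<gamma> K b' b'' \<tau> x - hsd_w_p \<gamma> K b b' b'' x)
    \<in> o[at_right 0](\<lambda>_. 1)"
proof (rule smallo_1I)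
  let ?w = "\<lambda>\<tau>. 1 / (\<gamma> * K\<^sup>2)
    + (b'' x * H b' \<tau> x + (b' x)\<^sup>2 * stretch \<tau> x) / (1 + \<tau>\<^sup>2 * (b' x)\<^sup>2) powr (3/2)"
  have "((\<lambda>\<tau>. (1 + \<tau>\<^sup>2 * (b' x)\<^sup>2) powr (3/2)) \<longlongrightarrow> (1 + 0\<^sup>2 * (b' x)\<^sup>2) powr (3/2)) (at_right 0)"
    by (intro tendsto_intros) auto
  then have "(?w \<longlongrightarrow> 1 / (\<gamma> * K\<^sup>2)
      + (b'' x * b x + (b' x)\<^sup>2 * 1) / (1 + 0\<^sup>2 * (b' x)\<^sup>2) powr (3/2)) (at_right 0)"
    using x by (intro tendsto_intros tendsto_H tendsto_stretch) auto
  also have "1 / (\<gamma> * K\<^sup>2) + (b'' x * b x + (b' x)\<^sup>2 * 1) / (1 + 0\<^sup>2 * (b' x)\<^sup>2) powr (3/2)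
      = hsd_w_p \<gamma> K b b' b'' x"
    by (simp add: hsd_w_p_def mult.commute)
  finally have "(?w \<longlongrightarrow> hsd_w_p \<gamma> K b b' b'' x) (at_right 0)" .
  moreover have "?w \<tau> = scaled_w_p rho_inf u_inf \<gamma> K b' b'' \<tau> x" if "\<tau> > 0" for \<tau>
  proof -
    have "\<gamma> * p_inf rho_inf u_inf \<gamma> K \<tau> * K\<^sup>2 = rho_inf * u_inf\<^sup>2 * \<tau>\<^sup>2"
      using assms by (simp add: p_inf_def)
    moreover have "p_inf rho_inf u_inf \<gamma> K \<tau> = rho_inf * u_inf\<^sup>2 * \<tau>\<^sup>2 * (1 / (\<gamma> * K\<^sup>2))"
      by (simp add: p_inf_def)
    ultimately show ?thesis
      using assms that by (simp add: scaled_w_p_def wedge_w_p_def stretch_def add_divide_distrib)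
  qed
  then have "\<forall>\<^sub>F \<tau> in at_right 0. ?w \<tau> = scaled_w_p rho_inf u_inf \<gamma> K b' b'' \<tau> x"
    by (auto simp: eventually_at_filter)
  ultimately show "((\<lambda>\<tau>. scaled_w_p rho_inf u_inf \<gamma> K b' b'' \<tau> x) \<longlongrightarrow> hsd_w_p \<gamma> K b b' b'' x) (at_right 0)"
    by (rule Lim_transform_eventually)
qed

section \<open>The reference measure\<close>

text \<open>The function that is constantly \<open>c\<close> on the domain above the graph and has the value \<open>f x\<close> at
  the boundary point \<open>(x, b x)\<close>. Both mass measures have densities of this form with respect to
  \<open>ref_measure b b'\<close>.\<close>

definition sheet_density :: "real \<Rightarrow> (real \<Rightarrow> real) \<Rightarrow> real \<times> real \<Rightarrow> real" where
  "sheet_density c f z = c * indicator (domain_above b) z + f (fst z) * indicator (graph_over b) z"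

lemma borel_domain_above [measurable]: "domain_above b \<in> sets borel"
proof -
  have "closed {z :: real \<times> real. 0 \<le> fst z}"
    by (intro closed_Collect_le continuous_intros)
  moreover have "open {z. b (max 0 (fst z)) < snd z}"
    by (intro open_Collect_less continuous_intros cont_extend cont_b)
  moreover have "domain_above b = {z. 0 \<le> fst z} \<inter> {z. b (max 0 (fst z)) < snd z}"
    by (auto simp: domain_above_def max_def)
  ultimately show ?thesis by auto
qed

lemma borel_graph_over [measurable]: "graph_over b \<in> sets borel"
proof -
  have "closed {z :: real \<times> real. 0 \<le> fst z}"
    by (intro closed_Collect_le continuous_intros)
  moreover have "closed {z. snd z = b (max 0 (fst z))}"
    by (intro closed_Collect_eq continuous_intros cont_extend cont_b)
  moreover have "graph_over b = {z. 0 \<le> fst z} \<inter> {z. snd z = b (max 0 (fst z))}"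
    by (auto simp: graph_over_def max_def)
  ultimately show ?thesis by auto
qed

lemma borel_sheet_density:
  assumes "continuous_on {0..} f"
  shows "sheet_density c f \<in> borel_measurable borel"
proof -
  have [measurable]: "(\<lambda>z :: real \<times> real. f (max 0 (fst z))) \<in> borel_measurable borel"
    using cont_extend[OF assms] by (rule borel_measurable_continuous_onI)
  have "sheet_density c f = (\<lambda>z. c * indicator (domain_above b) z
      + f (max 0 (fst z)) * indicator (graph_over b) z)"
    by (auto simp: fun_eq_iff sheet_density_def graph_over_def indicator_def max_def)
  then show ?thesis by simp
qed

lemma sets_ref_measure [simp, measurable_cong]: "sets (ref_measure b b') = sets borel"
  by (simp add: ref_measure_def)

lemma space_ref_measure [simp]: "space (ref_measure b b') = UNIV"
  using sets_eq_imp_space_eq[OF sets_ref_measure] by simp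

lemma nn_integral_ref_measure:
  assumes \<phi>: "\<phi> \<in> borel_measurable borel"
  shows "(\<integral>\<^sup>+z. \<phi> z \<partial>ref_measure b b') = (\<integral>\<^sup>+z\<in>domain_above b. \<phi> z \<partial>lborel)
    + (\<integral>\<^sup>+x\<in>{0..}. ennreal (stretch 1 x) * \<phi> (x, b x) \<partial>lborel)"
proof -
  have w: "weighted_dirac (\<lambda>_. 1) b b' = graph_measure (stretch 1) b"
    by (simp add: weighted_dirac_def stretch_def[abs_def])
  show ?thesis
    unfolding ref_measure_def w using \<phi> borel_on_half_line[OF cont_b] borel_on_half_line[OF cont_stretch]
    by (simp add: nn_integral_add_measure nn_integral_area_on nn_integral_graph_measure
        cong: measurable_cong_sets)
qed

lemma borel_curve_section:
  assumes w: "continuous_on {0..} w" and [measurable]: "\<phi> \<in> borel_measurable borel"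
  shows "(\<lambda>x. ennreal (w x) * \<phi> (x, b x) * indicator {0..} x) \<in> borel_measurable borel"
proof -
  have [measurable]: "(\<lambda>x. w (max 0 x)) \<in> borel_measurable borel"
    "(\<lambda>x. (x, b (max 0 x))) \<in> borel_measurable borel"
    by (intro borel_measurable_continuous_onI continuous_intros continuous_on_compose2[OF cont_b]
        continuous_on_compose2[OF w]; auto)+
  have "(\<lambda>x. ennreal (w x) * \<phi> (x, b x) * indicator {0..} x)
      = (\<lambda>x. ennreal (w (max 0 x)) * \<phi> (x, b (max 0 x)) * indicator {0..} x)"
    by (auto simp: fun_eq_iff indicator_def max_def)
  then show ?thesis by simp
qed

text \<open>Since the weight \<open>stretch 1\<close> is positive, null sets of the curve part are those whose
  projection to the \<open>x\<close>-axis is Lebesgue null.\<close>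

lemma null_sets_ref_measure_iff:
  assumes [measurable]: "A \<in> sets borel"
  shows "A \<in> null_sets (ref_measure b b') \<longleftrightarrow>
    (AE z in lborel. z \<in> domain_above b \<longrightarrow> z \<notin> A) \<and> (AE x in lborel. 0 \<le> x \<longrightarrow> (x, b x) \<notin> A)"
proof -
  have "A \<in> null_sets (ref_measure b b') \<longleftrightarrow> (\<integral>\<^sup>+z. indicator A z \<partial>ref_measure b b') = 0"
    by (simp add: null_sets_def)
  also have "\<dots> \<longleftrightarrow> (\<integral>\<^sup>+z\<in>domain_above b. indicator A z \<partial>lborel) = 0
      \<and> (\<integral>\<^sup>+x\<in>{0..}. ennreal (stretch 1 x) * indicator A (x, b x) \<partial>lborel) = 0"
    by (subst nn_integral_ref_measure) auto
  also have "(\<integral>\<^sup>+z\<in>domain_above b. indicator A z \<partial>lborel) = 0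
      \<longleftrightarrow> (AE z in lborel. z \<in> domain_above b \<longrightarrow> z \<notin> A)"
    by (subst nn_integral_0_iff_AE) (auto simp: indicator_def intro!: AE_cong)
  also have "(\<integral>\<^sup>+x\<in>{0..}. ennreal (stretch 1 x) * indicator A (x, b x) \<partial>lborel) = 0
      \<longleftrightarrow> (AE x in lborel. 0 \<le> x \<longrightarrow> (x, b x) \<notin> A)"
    using borel_curve_section[OF cont_stretch, of "indicator A" 1]
    by (subst nn_integral_0_iff_AE) (auto simp: indicator_def ennreal_eq_0_iff not_le intro!: AE_cong)
  finally show ?thesis .
qed

lemma AE_ref_measureD:
  assumes "AE z in ref_measure b b'. P z"
  shows "AE z in lborel. z \<in> domain_above b \<longrightarrow> P z" and "AE x in lborel. 0 \<le> x \<longrightarrow> P (x, b x)"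
proof -
  obtain N where N: "{z. \<not> P z} \<subseteq> N" "N \<in> null_sets (ref_measure b b')"
    using AE_E3[OF assms] by (metis (no_types, lifting) DiffI UNIV_I mem_Collect_eq space_ref_measure subsetI)
  then have "N \<in> sets borel" by auto
  with N show "AE z in lborel. z \<in> domain_above b \<longrightarrow> P z" "AE x in lborel. 0 \<le> x \<longrightarrow> P (x, b x)"
    by (auto simp: null_sets_ref_measure_iff elim!: eventually_mono)
qed

text \<open>The tip, where several coefficients are defined by limits, may therefore be ignored.\<close>

lemma AE_ref_measure_off_axis: "AE z in ref_measure b b'. fst z \<noteq> 0"
proof -
  have "emeasure lborel ({0} \<times> UNIV :: (real \<times> real) set) = 0"
    by (simp add: lborel_prod[symmetric] lborel.emeasure_pair_measure_Times)
  moreover have "{0} \<times> UNIV \<in> sets (borel :: (real \<times> real) measure)"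
    by (intro borel_closed closed_Times) auto
  ultimately have "{0} \<times> UNIV \<in> null_sets (lborel :: (real \<times> real) measure)"
    by auto
  then have "AE z in lborel. (z :: real \<times> real) \<notin> {0} \<times> UNIV" by (rule AE_not_in)
  moreover have "AE x in lborel. (x :: real) \<noteq> 0" by (rule AE_lborel_singleton)
  ultimately have "{0} \<times> UNIV \<in> null_sets (ref_measure b b')"
    using \<open>{0} \<times> UNIV \<in> sets borel\<close> by (subst null_sets_ref_measure_iff) (auto elim: eventually_mono)
  from AE_not_in[OF this] show ?thesis by (rule eventually_mono) (auto simp: mem_Times_iff)
qed

text \<open>Balls have finite measure. This is needed for the uniqueness of Radon--Nikodym derivatives.\<close>

lemma sigma_finite_ref_measure: "sigma_finite_measure (ref_measure b b')"
proof
  define C where "C n = cball (0 :: real \<times> real) (real n)" for n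
  have [measurable]: "C n \<in> sets borel" for n
    by (simp add: C_def borel_closed)
  have fin: "emeasure (ref_measure b b') (C n) < \<infinity>" for n
  proof -
    have "continuous_on {0..real n} (stretch 1)"
      by (rule continuous_on_subset[OF cont_stretch]) auto
    then have "bounded (stretch 1 ` {0..real n})"
      by (intro compact_imp_bounded compact_continuous_image) auto
    then obtain B where B: "\<And>x. 0 \<le> x \<Longrightarrow> x \<le> real n \<Longrightarrow> stretch 1 x \<le> B"
      by (auto simp: bounded_real) (metis abs_le_D1 atLeastAtMost_iff)
    have "(\<integral>\<^sup>+z\<in>domain_above b. indicator (C n) z \<partial>lborel) \<le> (\<integral>\<^sup>+z. indicator (C n) z \<partial>lborel)"
      by (intro nn_integral_mono) (auto simp: indicator_def)
    also have "\<dots> < \<infinity>"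
      using emeasure_lborel_cball_finite[of 0 "real n"] by (simp add: C_def)
    finally have 1: "(\<integral>\<^sup>+z\<in>domain_above b. indicator (C n) z \<partial>lborel) < \<infinity>" .
    have "x \<le> real n" if "(x, b x) \<in> C n" for x
      using that norm_fst_le[of x "b x"] by (auto simp: C_def)
    then have "(\<integral>\<^sup>+x\<in>{0..}. ennreal (stretch 1 x) * indicator (C n) (x, b x) \<partial>lborel)
        \<le> (\<integral>\<^sup>+x. ennreal B * indicator {0..real n} x \<partial>lborel)"
      by (intro nn_integral_mono) (auto simp: indicator_def B intro!: ennreal_leI)
    also have "\<dots> < \<infinity>"
      by (simp add: nn_integral_cmult ennreal_mult_less_top)
    finally have 2: "(\<integral>\<^sup>+x\<in>{0..}. ennreal (stretch 1 x) * indicator (C n) (x, b x) \<partial>lborel) < \<infinity>" .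
    have "emeasure (ref_measure b b') (C n) = (\<integral>\<^sup>+z. indicator (C n) z \<partial>ref_measure b b')"
      by simp
    also have "\<dots> < \<infinity>"
      using 1 2 by (subst nn_integral_ref_measure) auto
    finally show ?thesis .
  qed
  have "(\<Union>n. C n) = UNIV"
    using real_arch_simple by (auto simp: C_def)
  with fin show "\<exists>A. countable A \<and> A \<subseteq> sets (ref_measure b b') \<and> \<Union>A = space (ref_measure b b')
      \<and> (\<forall>a\<in>A. emeasure (ref_measure b b') a \<noteq> \<infinity>)"
    by (intro exI[of _ "range C"]) (auto simp: less_top[symmetric])
qed

section \<open>Densities with respect to the reference measure\<close>

lemma density_ref_measure:
  assumes c: "c \<ge> 0" and f: "continuous_on {0..} f" "\<And>x. x \<ge> 0 \<Longrightarrow> f x \<ge> 0"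
    and sets: "sets \<nu> = sets borel"
    and \<nu>: "\<And>A. A \<in> sets borel \<Longrightarrow> emeasure \<nu> A
      = ennreal c * (\<integral>\<^sup>+z\<in>domain_above b. indicator A z \<partial>lborel)
        + (\<integral>\<^sup>+x\<in>{0..}. ennreal (f x * stretch 1 x) * indicator A (x, b x) \<partial>lborel)"
  shows "density (ref_measure b b') (\<lambda>z. ennreal (sheet_density c f z)) = \<nu>"
proof (rule measure_eqI)
  fix A assume "A \<in> sets (density (ref_measure b b') (\<lambda>z. ennreal (sheet_density c f z)))"
  then have A [measurable]: "A \<in> sets borel" by simp
  note [measurable] = borel_sheet_density[OF f(1), of c]
  have "emeasure (density (ref_measure b b') (\<lambda>z. ennreal (sheet_density c f z))) A
      = (\<integral>\<^sup>+z\<in>A. ennreal (sheet_density c f z) \<partial>ref_measure b b')"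
    by (subst emeasure_density) (auto cong: measurable_cong_sets)
  also have "\<dots> = (\<integral>\<^sup>+z\<in>domain_above b. ennreal (sheet_density c f z) * indicator A z \<partial>lborel)
      + (\<integral>\<^sup>+x\<in>{0..}. ennreal (stretch 1 x) * (ennreal (sheet_density c f (x, b x)) * indicator A (x, b x)) \<partial>lborel)"
    by (subst nn_integral_ref_measure) auto
  also have "(\<integral>\<^sup>+z\<in>domain_above b. ennreal (sheet_density c f z) * indicator A z \<partial>lborel)
      = (\<integral>\<^sup>+z. ennreal c * (indicator A z * indicator (domain_above b) z) \<partial>lborel)"
    by (intro nn_integral_cong)
       (auto simp: sheet_density_def indicator_def domain_above_def graph_over_def)
  also have "\<dots> = ennreal c * (\<integral>\<^sup>+z\<in>domain_above b. indicator A z \<partial>lborel)"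
    by (rule nn_integral_cmult) measurable
  also have "(\<integral>\<^sup>+x\<in>{0..}. ennreal (stretch 1 x)
        * (ennreal (sheet_density c f (x, b x)) * indicator A (x, b x)) \<partial>lborel)
      = (\<integral>\<^sup>+x\<in>{0..}. ennreal (f x * stretch 1 x) * indicator A (x, b x) \<partial>lborel)"
    using f(2)
    by (intro nn_integral_cong)
       (auto simp: sheet_density_def indicator_def domain_above_def graph_over_def
          mult.commute ennreal_mult less_imp_le[OF stretch_pos])
  finally show "emeasure (density (ref_measure b b') (\<lambda>z. ennreal (sheet_density c f z))) A = emeasure \<nu> A"
    by (simp add: \<nu>)
qed (simp add: sets)

lemma continuous_density_sheet_density:
  assumes c: "c \<ge> 0" and f: "continuous_on {0..} f" "\<And>x. x \<ge> 0 \<Longrightarrow> f x \<ge> 0"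
    and \<nu>: "density (ref_measure b b') (\<lambda>z. ennreal (sheet_density c f z)) = \<nu>"
  shows "continuous_density b b' \<nu> (sheet_density c f)"
  unfolding continuous_density_def
proof (intro conjI ballI)
  interpret sigma_finite_measure "ref_measure b b'" by (rule sigma_finite_ref_measure)
  have m: "(\<lambda>z. ennreal (sheet_density c f z)) \<in> borel_measurable (ref_measure b b')"
    using borel_sheet_density[OF f(1), of c] by (simp cong: measurable_cong_sets)
  show "absolutely_continuous (ref_measure b b') \<nu>"
    using absolutely_continuousI_density[OF m] \<nu> by simp
  show "AE z in ref_measure b b'. RN_deriv (ref_measure b b') \<nu> z = ennreal (sheet_density c f z)"
    using RN_deriv_unique[OF m \<nu>] by (rule eventually_mono) simp
  show "0 \<le> sheet_density c f z" if "z \<in> domain_above b \<union> graph_over b" for z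
    using that c f(2)[of "fst z"]
    by (cases z) (auto simp: sheet_density_def domain_above_def graph_over_def split: split_indicator)
  have "continuous_on (domain_above b) (\<lambda>_. c)" by (intro continuous_intros)
  then show "continuous_on (domain_above b) (sheet_density c f)"
    by (rule continuous_on_eq) (auto simp: sheet_density_def indicator_def domain_above_def graph_over_def)
  have "continuous_on (graph_over b) (\<lambda>z. f (fst z))"
    by (rule continuous_on_compose2[OF f(1)], intro continuous_intros) (auto simp: graph_over_def)
  then show "continuous_on (graph_over b) (sheet_density c f)"
    by (rule continuous_on_eq) (auto simp: sheet_density_def indicator_def domain_above_def graph_over_def)
qed

text \<open>Two continuous versions agree almost everywhere for a fixed measure \<open>\<nu>\<close>, and by continuity they
  agree at every point of the domain and of the curve off the axis. The exceptional set thus does not depend on \<open>\<nu>\<close>, which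
  matters because \<open>\<nu>\<close> will range over the uncountable family of scaled mass measures.\<close>

lemma continuous_density_unique:
  assumes r: "continuous_density b b' \<nu> r" and s: "continuous_density b b' \<nu> s"
    and z: "z \<in> domain_above b \<union> graph_over b" "fst z \<noteq> 0"
  shows "r z = s z"
proof -
  let ?D = "{z. 0 < fst z} \<inter> {z. b (max 0 (fst z)) < snd z}"
  have "AE z in ref_measure b b'. ennreal (r z) = ennreal (s z)"
    using r s unfolding continuous_density_def by (auto elim: eventually_elim2)
  note ae = AE_ref_measureD[OF this]
  have eqD: "r z = s z" if "z \<in> domain_above b \<union> graph_over b" "ennreal (r z) = ennreal (s z)" for z
    using that r s by (simp add: continuous_density_def)
  consider (D) "z \<in> ?D" | (G) "0 < fst z" "z = (fst z, b (fst z))"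
    using z by (force simp: domain_above_def graph_over_def)
  then show ?thesis
  proof cases
    case D
    have sub: "?D \<subseteq> domain_above b" by (auto simp: domain_above_def)
    show ?thesis
    proof (rule AE_eq_imp_eq_on_open[where S = ?D and f = r and g = s])
      show "open ?D"
        by (intro open_Int open_Collect_less continuous_intros cont_extend cont_b)
      show "continuous_on ?D r" "continuous_on ?D s"
        using r s continuous_on_subset[OF _ sub] by (auto simp: continuous_density_def)
      show "AE z in lborel. z \<in> ?D \<longrightarrow> r z = s z"
        using ae(1) by (rule eventually_mono) (use sub eqD in blast)
    qed (rule D)
  next
    case G
    have "continuous_on {0<..} (\<lambda>x. q (x, b x))" if "continuous_on (graph_over b) q" for q :: "real \<times> real \<Rightarrow> real"
      by (rule continuous_on_compose2[OF that],
          intro continuous_intros continuous_on_subset[OF cont_b])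
         (auto simp: graph_over_def)
    then have "continuous_on {0<..} (\<lambda>x. r (x, b x))" "continuous_on {0<..} (\<lambda>x. s (x, b x))"
      using r s by (auto simp: continuous_density_def)
    moreover have "AE x in lborel. x \<in> {0<..} \<longrightarrow> r (x, b x) = s (x, b x)"
      using ae(2) by (rule eventually_mono) (auto intro: eqD simp: graph_over_def)
    ultimately have "r (fst z, b (fst z)) = s (fst z, b (fst z))"
      using G(1) by (intro AE_eq_imp_eq_on_open[where S = "{0<..}"
            and f = "\<lambda>x. r (x, b x)" and g = "\<lambda>x. s (x, b x)"]) auto
    with G(2) show ?thesis by simp
  qed
qed

text \<open>The density of the scaled mass measure on the curve, divided by \<open>\<tau>\<close>. The factor
  \<open>stretch \<tau> x / stretch 1 x\<close> converts physical arc length to arc length on the scaled boundary.\<close>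

definition scaled_curve_density :: "real \<Rightarrow> real \<Rightarrow> real" where
  "scaled_curve_density \<tau> x = (b x)\<^sup>2 / H b' \<tau> x * stretch \<tau> x / stretch 1 x"

lemma continuous_density_scaled_mass:
  assumes \<tau>: "\<tau> > 0" and rho: "rho_inf > 0"
  shows "continuous_density b b' (scaled_mass rho_inf b b' \<tau>)
    (sheet_density \<tau> (\<lambda>x. \<tau> * scaled_curve_density \<tau> x))"
proof (rule continuous_density_sheet_density)
  let ?f = "\<lambda>x. \<tau> * scaled_curve_density \<tau> x"
  show cont: "continuous_on {0..} ?f"
    unfolding scaled_curve_density_def
    by (intro continuous_intros cont_b_sq_over_H cont_stretch) auto
  show nonneg: "0 \<le> ?f x" if "x \<ge> 0" for x
  proof -
    have "H b' \<tau> x \<ge> 0" using that H_pos[of x \<tau>] by (cases "x = 0") auto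
    then show ?thesis using \<tau> by (simp add: scaled_curve_density_def less_imp_le)
  qed
  show "density (ref_measure b b') (\<lambda>z. ennreal (sheet_density \<tau> ?f z)) = scaled_mass rho_inf b b' \<tau>"
  proof (rule density_ref_measure[OF _ cont nonneg])
    show "sets (scaled_mass rho_inf b b' \<tau>) = sets borel" by (simp add: scaled_mass_def)
    fix A :: "(real \<times> real) set" assume [measurable]: "A \<in> sets borel"
    let ?I = "\<integral>\<^sup>+z\<in>domain_above b. indicator A z \<partial>lborel"
    let ?g = "\<lambda>x. ennreal (scaled_curve_density \<tau> x * stretch 1 x) * indicator A (x, b x) * indicator {0..} x"
    have "continuous_on {0..} (\<lambda>x. scaled_curve_density \<tau> x * stretch 1 x)"
      unfolding scaled_curve_density_def
      by (intro continuous_intros cont_b_sq_over_H cont_stretch) auto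
    then have [measurable]: "?g \<in> borel_measurable borel"
      by (rule borel_curve_section) simp
    have "emeasure (scaled_mass rho_inf b b' \<tau>) A
        = (\<integral>\<^sup>+z. indicator A z \<partial>scaled_mass rho_inf b b' \<tau>)"
      by (simp add: scaled_mass_def)
    also have "\<dots> = ennreal \<tau> * (?I
        + (\<integral>\<^sup>+x\<in>{0..}. ennreal (wedge_w_rho rho_inf b b' \<tau> x / (\<tau> * rho_inf)
             * sqrt (1 + \<tau>\<^sup>2 * (b' x)\<^sup>2)) * indicator A (x, b x) \<partial>lborel))"
      by (rule nn_integral_scaled_mass[OF \<tau> cont_b cont_b']) simp
    also have "(\<integral>\<^sup>+x\<in>{0..}. ennreal (wedge_w_rho rho_inf b b' \<tau> x / (\<tau> * rho_inf)
        * sqrt (1 + \<tau>\<^sup>2 * (b' x)\<^sup>2)) * indicator A (x, b x) \<partial>lborel) = (\<integral>\<^sup>+x. ?g x \<partial>lborel)"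
      \<comment> \<open>the value of \<open>wedge_w_rho\<close> at the tip is irrelevant\<close>
      using \<tau> rho
      by (intro nn_integral_cong_AE eventually_mono[OF AE_lborel_singleton[of 0]])
         (simp add: wedge_w_rho_def ext0_def scaled_curve_density_def stretch_def[symmetric])
    also have "ennreal \<tau> * (?I + (\<integral>\<^sup>+x. ?g x \<partial>lborel))
        = ennreal \<tau> * ?I + (\<integral>\<^sup>+x. ennreal \<tau> * ?g x \<partial>lborel)"
      by (simp add: distrib_left nn_integral_cmult)
    also have "(\<lambda>x. ennreal \<tau> * ?g x)
        = (\<lambda>x. ennreal (?f x * stretch 1 x) * indicator A (x, b x) * indicator {0..} x)"
      using \<tau> by (simp add: fun_eq_iff ennreal_mult' mult.assoc)
    finally show "emeasure (scaled_mass rho_inf b b' \<tau>) A = ennreal \<tau> * ?I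
        + (\<integral>\<^sup>+x\<in>{0..}. ennreal (?f x * stretch 1 x) * indicator A (x, b x) \<partial>lborel)" .
  qed (use \<tau> in auto)
qed (use \<tau> in auto)

lemma continuous_density_hsd_mass:
  "continuous_density b b' (hsd_mass b b') (sheet_density 1 (\<lambda>x. b x / stretch 1 x))"
proof (rule continuous_density_sheet_density)
  let ?f = "\<lambda>x. b x / stretch 1 x"
  show cont: "continuous_on {0..} ?f"
    by (intro continuous_intros cont_b cont_stretch) auto
  show nonneg: "0 \<le> ?f x" if "x \<ge> 0" for x
    using that b_pos[of x] by (cases "x = 0") (auto simp: less_imp_le)
  show "density (ref_measure b b') (\<lambda>z. ennreal (sheet_density 1 ?f z)) = hsd_mass b b'"
  proof (rule density_ref_measure[OF _ cont nonneg])
    show "sets (hsd_mass b b') = sets borel" by (simp add: hsd_mass_def)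
    fix A :: "(real \<times> real) set" assume [measurable]: "A \<in> sets borel"
    have w: "weighted_dirac (\<lambda>x. b x / sqrt (1 + (b' x)\<^sup>2)) b b' = graph_measure (\<lambda>x. ?f x * stretch 1 x) b"
      by (simp add: weighted_dirac_def stretch_def)
    have c: "continuous_on {0..} (\<lambda>x. ?f x * stretch 1 x)"
      by (intro continuous_intros cont_b cont_stretch) auto
    have "emeasure (hsd_mass b b') A = (\<integral>\<^sup>+z. indicator A z \<partial>hsd_mass b b')"
      by (simp add: hsd_mass_def)
    also have "\<dots> = (\<integral>\<^sup>+z\<in>domain_above b. indicator A z \<partial>lborel)
        + (\<integral>\<^sup>+x\<in>{0..}. ennreal (?f x * stretch 1 x) * indicator A (x, b x) \<partial>lborel)"
      unfolding hsd_mass_def w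
      using nn_integral_graph_measure[OF borel_on_half_line[OF c] borel_on_half_line[OF cont_b], of "indicator A"]
        nn_integral_area_on[OF borel_domain_above, of "indicator A"]
      by (subst nn_integral_add_measure) (auto cong: measurable_cong_sets)
    finally show "emeasure (hsd_mass b b') A
        = ennreal 1 * (\<integral>\<^sup>+z\<in>domain_above b. indicator A z \<partial>lborel)
        + (\<integral>\<^sup>+x\<in>{0..}. ennreal (?f x * stretch 1 x) * indicator A (x, b x) \<partial>lborel)"
      by simp
  qed auto
qed auto

lemma tendsto_scaled_curve_density:
  assumes "x > 0"
  shows "((\<lambda>\<tau>. scaled_curve_density \<tau> x) \<longlongrightarrow> b x / stretch 1 x) (at_right 0)"
proof -
  have bx: "b x \<noteq> 0" using b_pos[OF assms] by simp
  then have "((\<lambda>\<tau>. scaled_curve_density \<tau> x) \<longlongrightarrow> (b x)\<^sup>2 / b x * 1 / stretch 1 x) (at_right 0)"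
    unfolding scaled_curve_density_def using assms
    by (intro tendsto_intros tendsto_H tendsto_stretch) auto
  with bx show ?thesis by (simp add: power2_eq_square)
qed

lemma density_smallo:
  assumes rho: "rho_inf > 0"
    and rs: "\<forall>\<^sub>F \<tau> in at_right 0. continuous_density b b' (scaled_mass rho_inf b b' \<tau>) (rs \<tau>)"
    and r: "continuous_density b b' (hsd_mass b b') r"
    and z: "z \<in> domain_above b \<union> graph_over b" "fst z \<noteq> 0"
  shows "(\<lambda>\<tau>. rs \<tau> z - \<tau> * r z) \<in> o[at_right 0](\<lambda>\<tau>. \<tau>)"
proof (rule smalloI_tendsto)
  let ?q = "\<lambda>\<tau>. sheet_density 1 (scaled_curve_density \<tau>) z"
  have x: "fst z > 0" using z by (auto simp: domain_above_def graph_over_def)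
  have rz: "r z = sheet_density 1 (\<lambda>x. b x / stretch 1 x) z"
    by (rule continuous_density_unique[OF r continuous_density_hsd_mass z])
  have pos: "\<forall>\<^sub>F \<tau> in at_right 0. (0 :: real) < \<tau>"
    by (auto simp: eventually_at_filter)
  have "(?q \<longlongrightarrow> r z) (at_right 0)"
    unfolding rz sheet_density_def using x by (intro tendsto_intros tendsto_scaled_curve_density)
  then have "((\<lambda>\<tau>. ?q \<tau> - r z) \<longlongrightarrow> 0) (at_right 0)" by (rule LIM_zero)
  moreover from rs pos have "\<forall>\<^sub>F \<tau> in at_right 0. ?q \<tau> - r z = (rs \<tau> z - \<tau> * r z) / \<tau>"
  proof eventually_elim
    case (elim \<tau>)
    have "rs \<tau> z = sheet_density \<tau> (\<lambda>x. \<tau> * scaled_curve_density \<tau> x) z"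
      by (rule continuous_density_unique[OF elim(1) continuous_density_scaled_mass[OF elim(2) rho] z])
    also have "\<dots> = \<tau> * ?q \<tau>"
      by (simp add: sheet_density_def distrib_left)
    finally show ?case using elim by (simp add: field_simps)
  qed
  ultimately show "((\<lambda>\<tau>. (rs \<tau> z - \<tau> * r z) / \<tau>) \<longlongrightarrow> 0) (at_right 0)"
    by (rule Lim_transform_eventually)
  show "\<forall>\<^sub>F \<tau> in at_right 0. (\<tau> :: real) \<noteq> 0" by (auto simp: eventually_at_filter)
qed

end

section \<open>The limit theorem\<close>

theorem theorem2p3:
  fixes \<gamma> K rho_inf u_inf :: real and b b' b'' :: "real \<Rightarrow> real"
  assumes "\<gamma> > 1" and "K > 0" and "rho_inf > 0" and "u_inf > 0"
    and "\<And>x. x \<ge> 0 \<Longrightarrow> (b has_real_derivative b' x) (at x within {0..})"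
    and "\<And>x. x \<ge> 0 \<Longrightarrow> (b' has_real_derivative b'' x) (at x within {0..})"
    and "continuous_on {0..} b''"
    and "b 0 = 0"
    and "\<And>x. x \<ge> 0 \<Longrightarrow> b' x > 0"
    and "\<And>x. x \<ge> 0 \<Longrightarrow> 1 / (\<gamma> * K\<^sup>2) + (b' x)\<^sup>2 + b x * b'' x > 0"
    and "\<forall>\<^sub>F \<tau> in at_right 0. \<forall>x\<ge>0.
           (1 + \<tau>\<^sup>2 * (b' x)\<^sup>2) powr (3/2) / (\<gamma> * K\<^sup>2)
           + b'' x * H b' \<tau> x + (b' x)\<^sup>2 * sqrt (1 + \<tau>\<^sup>2 * (b' x)\<^sup>2) > 0"
  shows
    "(AE z in ref_measure b b'. z \<in> domain_above b \<union> graph_over b \<longrightarrow>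
        (\<lambda>\<tau>. scaled_u u_inf b b' \<tau> z - hsd_u b b' b'' z) \<in> o[at_right 0](\<lambda>_. 1) \<and>
        (\<lambda>\<tau>. scaled_v u_inf b b' \<tau> z - hsd_v b b' z) \<in> o[at_right 0](\<lambda>_. 1) \<and>
        (\<lambda>\<tau>. scaled_E u_inf \<gamma> K b \<tau> z - hsd_E \<gamma> K b z) \<in> o[at_right 0](\<lambda>_. 1)) \<and>
     (\<forall>\<^sub>F \<tau> in at_right 0. \<exists>r. continuous_density b b' (scaled_mass rho_inf b b' \<tau>) r) \<and>
     (\<exists>r. continuous_density b b' (hsd_mass b b') r) \<and>
     (\<forall>rs r. (\<forall>\<^sub>F \<tau> in at_right 0. continuous_density b b' (scaled_mass rho_inf b b' \<tau>) (rs \<tau>)) \<longrightarrow>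
        continuous_density b b' (hsd_mass b b') r \<longrightarrow>
        (AE z in ref_measure b b'. z \<in> domain_above b \<union> graph_over b \<longrightarrow>
          (\<lambda>\<tau>. rs \<tau> z - \<tau> * r z) \<in> o[at_right 0](\<lambda>\<tau>. \<tau>))) \<and>
     (\<forall>x\<ge>0. (\<lambda>\<tau>. scaled_w_p rho_inf u_inf \<gamma> K b' b'' \<tau> x - hsd_w_p \<gamma> K b b' b'' x) \<in> o[at_right 0](\<lambda>_. 1))"
proof -
  interpret wedge_profile b b' b''
    using assms by unfold_locales auto
  have pos: "\<forall>\<^sub>F \<tau> in at_right 0. (0 :: real) < \<tau>"
    by (auto simp: eventually_at_filter)
  have E: "(\<lambda>\<tau>. scaled_E u_inf \<gamma> K b \<tau> z - hsd_E \<gamma> K b z) \<in> o[at_right 0](\<lambda>_. 1)"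
    if "z \<in> domain_above b \<union> graph_over b" for z
  proof (rule smallo_1I)
    have "\<forall>\<^sub>F \<tau> in at_right 0. hsd_E \<gamma> K b z = scaled_E u_inf \<gamma> K b \<tau> z"
      using pos by (rule eventually_mono) (rule scaled_E_eq[OF \<open>u_inf > 0\<close> _ that, symmetric])
    then show "((\<lambda>\<tau>. scaled_E u_inf \<gamma> K b \<tau> z) \<longlongrightarrow> hsd_E \<gamma> K b z) (at_right 0)"
      by (rule Lim_transform_eventually[OF tendsto_const])
  qed
  show ?thesis
  proof (intro conjI allI impI)
    show "AE z in ref_measure b b'. z \<in> domain_above b \<union> graph_over b \<longrightarrow>
        (\<lambda>\<tau>. scaled_u u_inf b b' \<tau> z - hsd_u b b' b'' z) \<in> o[at_right 0](\<lambda>_. 1) \<and>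
        (\<lambda>\<tau>. scaled_v u_inf b b' \<tau> z - hsd_v b b' z) \<in> o[at_right 0](\<lambda>_. 1) \<and>
        (\<lambda>\<tau>. scaled_E u_inf \<gamma> K b \<tau> z - hsd_E \<gamma> K b z) \<in> o[at_right 0](\<lambda>_. 1)"
      using AE_ref_measure_off_axis
      by (rule eventually_mono) (intro impI conjI scaled_u_smallo scaled_v_smallo E \<open>u_inf > 0\<close>)
    show "\<forall>\<^sub>F \<tau> in at_right 0. \<exists>r. continuous_density b b' (scaled_mass rho_inf b b' \<tau>) r"
      using pos by (rule eventually_mono) (use continuous_density_scaled_mass \<open>rho_inf > 0\<close> in blast)
    show "\<exists>r. continuous_density b b' (hsd_mass b b') r"
      using continuous_density_hsd_mass by blast
    show "AE z in ref_measure b b'. z \<in> domain_above b \<union> graph_over b \<longrightarrow>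
        (\<lambda>\<tau>. rs \<tau> z - \<tau> * r z) \<in> o[at_right 0](\<lambda>\<tau>. \<tau>)"
      if "\<forall>\<^sub>F \<tau> in at_right 0. continuous_density b b' (scaled_mass rho_inf b b' \<tau>) (rs \<tau>)"
        "continuous_density b b' (hsd_mass b b') r" for rs r
      using AE_ref_measure_off_axis
      by (rule eventually_mono) (use density_smallo[OF \<open>rho_inf > 0\<close> that] in blast)
    show "(\<lambda>\<tau>. scaled_w_p rho_inf u_inf \<gamma> K b' b'' \<tau> x - hsd_w_p \<gamma> K b b' b'' x)
        \<in> o[at_right 0](\<lambda>_. 1)" if "x \<ge> 0" for x
      using assms that by (intro scaled_w_p_smallo) auto
  qed
qed

end
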